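(* Let $r\ge 1$ and let $0<s_1\le s_2\le\cdots\le s_r$ be integers. Let $U=(U_{ij})_{1\le i\le r,\,1\le j\le s_r}$ be the random $r\times s_r$ real matrix such that $U_{ij}=u_{i,j}$ for $1\le j\le s_i$ and $U_{ij}=0$ for $s_i<j\le s_r$, where the $u_{i,j}$ ($1\le i\le r$, $1\le j\le s_i$) are independent standard Gaussian $N(0,1)$ random variables. Then the distribution of the random symmetric matrix $X=U\,{}^{t}U$ is the Riesz distribution $R_r\!\left(s,\tfrac{1}{2}I_r\right)$ with $s=\left(\tfrac{s_1}{2},\ldots,\tfrac{s_r}{2}\right)$.
   Context: Let $V$ be the space of real symmetric $r\times r$ matrices with scalar product $\langle \theta,x\rangle=\mathrm{tr}(\theta x)$, let $\Omega\subset V$ be the cone of positive definite matrices, and let $I_r$ be the identity matrix. The Laplace transform of a positive measure $\mu$ on $V$ is $L_\mu(\theta)=\int_V e^{\langle\theta,x\rangle}\mu(dx)$. Generalized power: for $x\in\Omega$ and $1\le k\le r$, let $\Delta_k(x)$ be the leading principal minor of order $k$ of $x$ (the determinant of the block formed by the first $k$ rows and columns). For $t=(t_1,\ldots,t_r)\in\mathbb{R}^r$, $$\Delta_t(x)=\Delta_1(x)^{t_1-t_2}\Delta_2(x)^{t_2-t_3}\cdots\Delta_{r-1}(x)^{t_{r-1}-t_r}\Delta_r(x)^{t_r}.$$ The set $\Xi$: for real $u\ge 0$ put $\varepsilon(u)=0$ if $u=0$ and $\varepsilon(u)=1$ if $u>0$. Then $\Xi\subset\mathbb{R}^r$ is the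 set of all $(t_1,\ldots,t_r)$ of the form $t_1=u_1$ and $t_k=u_k+\frac12(\varepsilon(u_1)+\cdots+\varepsilon(u_{k-1}))$ for $2\le k\le r$, with $u_1,\ldots,u_r\ge 0$. Riesz measure and Riesz distribution: by a theorem of Gindikin, there exists a positive measure $R_t$ on $V$ whose Laplace transform is defined on $-\Omega$ and equals $L_{R_t}(\theta)=\Delta_t(-\theta^{-1})$ for $\theta\in-\Omega$ if and only if $t\in\Xi$. For $t\in\Xi$ and $\sigma\in\Omega$, the Riesz distribution $R_r(t,\sigma)$ is the probability measure on $V$ $$R_r(t,\sigma)(dx)=\frac{e^{-\langle\sigma,x\rangle}}{\Delta_t(\sigma^{-1})}R_t(dx).$$ Its Laplace transform is defined for $\theta\in\sigma-\Omega$ and equals $\Delta_t((\sigma-\theta)^{-1})/\Delta_t(\sigma^{-1})$. Interpretation of $U$: its columns are $s_r$ independent observations of an $N_r(0,I_r)$ vector, the missing components being replaced by $0$. The first $s_1$ columns are complete observations, and for $1\le i\le r-1$ the next $s_{i+1}-s_i$ columns are observations whose first $i$ components are missing. *)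

theory Defs
  imports "HOL-Probability.Probability" "Jordan_Normal_Form.Determinant"
    "Jordan_Normal_Form.Gauss_Jordan_Elimination"
begin

text \<open>
  Matrix entries are indexed from 0, as everywhere in the AFP matrix library. Parameters
  \<open>t \<in> \<real>\<^sup>r\<close> are functions \<open>t :: nat \<Rightarrow> real\<close> indexed from 1, of which only the values
  \<open>t 1, \<dots>, t r\<close> matter.
\<close>

definition sym_mats :: "nat \<Rightarrow> real mat set" where
  "sym_mats r = {x \<in> carrier_mat r r. transpose_mat x = x}"

definition mat_inner :: "real mat \<Rightarrow> real mat \<Rightarrow> real" where
  "mat_inner \<theta> x = (\<Sum>i<dim_row (\<theta> * x). (\<theta> * x) $$ (i, i))"

definition pos_def_mats :: "nat \<Rightarrow> real mat set" where
  "pos_def_mats r =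
     {x \<in> sym_mats r. \<forall>v \<in> carrier_vec r. v \<noteq> 0\<^sub>v r \<longrightarrow> scalar_prod v (x *\<^sub>v v) > 0}"

text \<open>
  The AFP type of matrices carries no topology. The Borel sets of the space of symmetric
  matrices are obtained by pulling back those of \<open>\<real>\<^sup>r\<^sup>\<times>\<^sup>r\<close> along the entries,
  which embed symmetric matrices linearly into \<open>\<real>\<^sup>r\<^sup>\<times>\<^sup>r\<close>.
\<close>

definition sym_borel :: "nat \<Rightarrow> real mat measure" where
  "sym_borel r = vimage_algebra (sym_mats r)
     (\<lambda>x. \<lambda>p\<in>{..<r} \<times> {..<r}. x $$ p) (\<Pi>\<^sub>M p\<in>{..<r} \<times> {..<r}. borel)"

definition laplace :: "real mat measure \<Rightarrow> real mat \<Rightarrow> ennreal" where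
  "laplace \<mu> \<theta> = (\<integral>\<^sup>+x. ennreal (exp (mat_inner \<theta> x)) \<partial>\<mu>)"

text \<open>Meaningful for invertible matrices only.\<close>

definition mat_inv :: "real mat \<Rightarrow> real mat" where
  "mat_inv x = the (mat_inverse x)"

definition leading_minor :: "nat \<Rightarrow> real mat \<Rightarrow> real" where
  "leading_minor k x = Determinant.det (Matrix.mat k k (\<lambda>p. x $$ p))"

definition gen_power :: "nat \<Rightarrow> (nat \<Rightarrow> real) \<Rightarrow> real mat \<Rightarrow> real" where
  "gen_power r t x =
     (\<Prod>k = 1..<r. leading_minor k x powr (t k - t (k + 1))) * leading_minor r x powr t r"

definition eps :: "real \<Rightarrow> real" where
  "eps u = (if u = 0 then 0 else 1)"

definition Xi :: "nat \<Rightarrow> (nat \<Rightarrow> real) set" where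
  "Xi r = {t. \<exists>u. \<forall>k\<in>{1..r}. u k \<ge> 0 \<and> t k = u k + 1/2 * (\<Sum>i = 1..<k. eps (u i))}"

definition is_riesz_measure :: "nat \<Rightarrow> (nat \<Rightarrow> real) \<Rightarrow> real mat measure \<Rightarrow> bool" where
  "is_riesz_measure r t R \<longleftrightarrow> sets R = sets (sym_borel r) \<and>
     (\<forall>\<theta>. - \<theta> \<in> pos_def_mats r \<longrightarrow> laplace R \<theta> = ennreal (gen_power r t (- mat_inv \<theta>)))"

text \<open>
  Existence holds exactly for \<open>t \<in> Xi r\<close> (Gindikin), and uniqueness is the injectivity of
  the Laplace transform.
\<close>

definition riesz_measure :: "nat \<Rightarrow> (nat \<Rightarrow> real) \<Rightarrow> real mat measure" where
  "riesz_measure r t = (THE R. is_riesz_measure r t R)"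

definition riesz_distribution :: "nat \<Rightarrow> (nat \<Rightarrow> real) \<Rightarrow> real mat \<Rightarrow> real mat measure" where
  "riesz_distribution r t \<sigma> = density (riesz_measure r t)
     (\<lambda>x. ennreal (exp (- mat_inner \<sigma> x) / gen_power r t (mat_inv \<sigma>)))"

end

theory Submission
  imports Defs
begin

text \<open>
  The Riesz measure is only characterised by its Laplace transform, so the claim splits into a
  computation and a uniqueness statement.

  Computation. Write a positive definite \<open>A\<close> as \<open>A = L\<^sup>T L\<close> with \<open>L\<close> lower triangular and positive
  diagonal entries \<open>l\<^sub>k\<^sub>k\<close> (\<open>reverse_cholesky\<close>). Two things become transparent. First,
  \<open>L A\<inverse> L\<^sup>T = 1\<close>, and since \<open>L\<close> is lower triangular the leading blocks satisfy the same
  identity, so the generalized power of \<open>A\<inverse>\<close> telescopes to the product of the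
  \<open>(1 / l\<^sub>k\<^sub>k\<^sup>2) powr t\<^sub>k\<close> (\<open>gen_power_inverse\<close>). Second, \<open>tr (A U U\<^sup>T)\<close> is the sum of the squares of
  the entries of \<open>L U\<close>. The nonzero rows of \<open>U\<close> grow longer downwards, so \<open>L U\<close> has the same staircase of
  zeros as \<open>U\<close>, and its \<open>(k, m)\<close> entry is \<open>l\<^sub>k\<^sub>k u\<^sub>k\<^sub>m\<close> plus a combination of the \<open>u\<^sub>i\<^sub>m\<close> with \<open>i < k\<close>
  (\<open>mat_inner_staircase\<close>). Integrating out the Gaussian variables from the bottom row upwards is then a
  succession of affine substitutions on the line, and each variable of row \<open>k\<close> contributes the factor
  \<open>1 / (\<surd>2 l\<^sub>k\<^sub>k)\<close> (\<open>nn_integral_gaussian_triangular\<close>). With \<open>s\<^sub>k\<close> variables in row \<open>k\<close> this gives the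
  generalized power with \<open>t\<^sub>k = s\<^sub>k / 2\<close>. Hence the law of \<open>U U\<^sup>T\<close>, multiplied by the density
  \<open>c exp (tr x / 2)\<close> where \<open>c\<close> is the generalized power at \<open>2 I\<close>, is a Riesz measure.

  Uniqueness (\<open>laplace_injective\<close>). The measure just found is carried by the set where all
  \<open>\<langle>A, x\<rangle>\<close> are nonnegative. Any competitor with the same Laplace transform is carried by the same
  set, because \<open>L(-k A)\<close> stays bounded as \<open>k\<close> grows. Choosing positive definite matrices
  \<open>A\<^sub>p\<close> that span the symmetric matrices, the coordinates \<open>exp (-\<langle>A\<^sub>p, x\<rangle>)\<close> lie in \<open>[0, 1]\<close> and
  their mixed moments are values of the Laplace transform. By the Weierstrass theorem, mixed moments
  determine a finite measure on a cube.
\<close>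

section \<open>Finite measures on a cube are determined by their mixed moments\<close>

text \<open>
  Equal moments give equal integrals of polynomials, and polynomials are uniformly dense in the
  continuous functions on \<open>[0, 1]\<close>.
\<close>

lemma integral_continuous_eq_if_moments_eq:
  fixes M N :: "real measure"
  assumes M: "finite_measure M" "sets M = sets borel" "AE x in M. x \<in> {0..1}"
    and N: "finite_measure N" "sets N = sets borel" "AE x in N. x \<in> {0..1}"
    and moments: "\<And>n. (\<integral>x. x ^ n \<partial>M) = (\<integral>x. x ^ n \<partial>N)"
    and f: "continuous_on UNIV f"
  shows "(\<integral>x. f x \<partial>M) = (\<integral>x. f x \<partial>N :: real)"
proof -
  have bounded_int: "integrable K g"
    if K: "finite_measure K" "sets K = sets borel" "AE x in K. x \<in> {0..1}"
      and g: "continuous_on UNIV g" for K :: "real measure" and g :: "real \<Rightarrow> real"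
  proof -
    interpret K: finite_measure K by fact
    have "compact (g ` {0..1})"
      using g by (intro compact_continuous_image) (auto intro: continuous_on_subset)
    then obtain B where "\<And>x. x \<in> {0..1} \<Longrightarrow> norm (g x) \<le> B"
      using compact_imp_bounded[of "g ` {0..1}"] unfolding bounded_iff by blast
    moreover have "g \<in> borel_measurable K"
      by (simp add: measurable_cong_sets[OF K(2) refl] borel_measurable_continuous_onI g)
    ultimately show ?thesis
      using K(3) by (intro K.integrable_const_bound[of _ B]) auto
  qed
  have poly: "(\<integral>x. p x \<partial>M) = (\<integral>x. p x \<partial>N)" if p: "real_polynomial_function p" for p :: "real \<Rightarrow> real"
  proof -
    from p obtain a n where p: "p = (\<lambda>x. \<Sum>i\<le>n. a i * x ^ i)"
      by (auto simp: real_polynomial_function_iff_sum)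
    have "integrable M (\<lambda>x. a i * x ^ i)" "integrable N (\<lambda>x. a i * x ^ i)" for i
      by (auto intro!: bounded_int M N continuous_intros)
    then show ?thesis
      by (simp add: p moments)
  qed
  define C where "C = measure M (space M) + measure N (space N)"
  have approx: "\<bar>(\<integral>x. f x \<partial>M) - (\<integral>x. f x \<partial>N)\<bar> \<le> e * C" if "e > 0" for e
  proof -
    obtain p where p: "real_polynomial_function p" "\<And>x. x \<in> {0..1} \<Longrightarrow> \<bar>f x - p x\<bar> < e"
      using Stone_Weierstrass_real_polynomial_function[OF compact_Icc
          continuous_on_subset[OF f subset_UNIV] \<open>e > 0\<close>, of 0 1] by blast
    have pc: "continuous_on UNIV p"
      using p(1) by (simp add: continuous_on_polymonial_function real_polynomial_function_eq)
    have close: "\<bar>(\<integral>x. f x \<partial>K) - (\<integral>x. p x \<partial>K)\<bar> \<le> e * measure K (space K)"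
      if K: "finite_measure K" "sets K = sets borel" "AE x in K. x \<in> {0..1}" for K
    proof -
      interpret K: finite_measure K by fact
      have fi: "integrable K f" "integrable K p" using bounded_int[OF K f] bounded_int[OF K pc] by auto
      then have "\<bar>(\<integral>x. f x \<partial>K) - (\<integral>x. p x \<partial>K)\<bar> = \<bar>\<integral>x. f x - p x \<partial>K\<bar>" by simp
      also have "\<dots> \<le> (\<integral>x. \<bar>f x - p x\<bar> \<partial>K)"
        by (rule integral_abs_bound)
      also have "\<dots> \<le> (\<integral>x. e \<partial>K)"
      proof (intro integral_mono_AE)
        show "AE x in K. \<bar>f x - p x\<bar> \<le> e"
          using K(3) by eventually_elim (rule less_imp_le[OF p(2)])
      qed (use fi in auto)
      finally show ?thesis by (simp add: mult.commute)
    qed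
    have "\<bar>(\<integral>x. f x \<partial>M) - (\<integral>x. p x \<partial>M)\<bar> \<le> e * measure M (space M)"
         "\<bar>(\<integral>x. f x \<partial>N) - (\<integral>x. p x \<partial>N)\<bar> \<le> e * measure N (space N)"
      by (intro close M N)+
    with poly[OF p(1)] show ?thesis by (simp add: C_def algebra_simps)
  qed
  have "C \<ge> 0" by (simp add: C_def)
  have "\<bar>(\<integral>x. f x \<partial>M) - (\<integral>x. f x \<partial>N)\<bar> \<le> 0"
  proof (rule field_le_epsilon)
    fix d :: real assume "d > 0"
    have "\<bar>(\<integral>x. f x \<partial>M) - (\<integral>x. f x \<partial>N)\<bar> \<le> d / (C + 1) * C"
      using \<open>d > 0\<close> \<open>C \<ge> 0\<close> by (intro approx) auto
    also have "\<dots> \<le> d" using \<open>d > 0\<close> \<open>C \<ge> 0\<close> by (simp add: field_simps)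
    finally show "\<bar>(\<integral>x. f x \<partial>M) - (\<integral>x. f x \<partial>N)\<bar> \<le> 0 + d" by simp
  qed
  then show ?thesis by simp
qed

lemma measure_eq_if_moments_eq:
  fixes M N :: "real measure"
  assumes M: "finite_measure M" "sets M = sets borel" "AE x in M. x \<in> {0..1}"
    and N: "finite_measure N" "sets N = sets borel" "AE x in N. x \<in> {0..1}"
    and moments: "\<And>n. (\<integral>x. x ^ n \<partial>M) = (\<integral>x. x ^ n \<partial>N)"
  shows "M = N"
proof (rule cdf_unique')
  show fbM: "finite_borel_measure M"
    using M by (auto simp: finite_borel_measure_def finite_borel_measure_axioms_def)
  show fbN: "finite_borel_measure N"
    using N by (auto simp: finite_borel_measure_def finite_borel_measure_axioms_def)
  show "cdf M = cdf N"
  proof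
    fix a :: real
    \<comment> \<open>A ramp that falls from 1 at \<open>a\<close> to 0 at \<open>a + 1 / k\<close>; it converges to the indicator of \<open>{..a}\<close>.\<close>
    define g where "g k x = max 0 (min 1 (1 - real k * (x - a)))" for k and x :: real
    have g_bd: "norm (g k x) \<le> 1" for k x by (auto simp: g_def)
    have g_lim: "(\<lambda>k. g k x) \<longlonglongrightarrow> indicator {..a} x" for x
    proof (cases "x \<le> a")
      case True
      then have "real k * (x - a) \<le> 0" for k by (simp add: mult_nonneg_nonpos)
      then have "g k x = 1" for k unfolding g_def
        by (smt (verit) \<open>\<And>k. real k * (x - a) \<le> 0\<close>)
      then show ?thesis using True by simp
    next
      case False
      then obtain n where n: "real n * (x - a) > 1"
        by (metis diff_gt_0_iff_gt mult.commute not_le reals_Archimedean3)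
      have "g k x = 0" if "k \<ge> n" for k
      proof -
        have "real n * (x - a) \<le> real k * (x - a)"
          using that False by (intro mult_right_mono) auto
        with n show ?thesis by (simp add: g_def)
      qed
      then have "eventually (\<lambda>k. g k x = 0) sequentially"
        by (auto simp: eventually_sequentially)
      then have "(\<lambda>k. g k x) \<longlonglongrightarrow> 0" by (rule tendsto_eventually)
      then show ?thesis using False by simp
    qed
    have g_cont: "continuous_on UNIV (g k)" for k
      unfolding g_def by (intro continuous_intros)
    have lim: "(\<lambda>k. \<integral>x. g k x \<partial>K) \<longlonglongrightarrow> cdf K a" if K: "finite_measure K" "sets K = sets borel" for K
    proof -
      interpret K: finite_measure K by fact
      have m: "g k \<in> borel_measurable K" for k
        by (simp add: measurable_cong_sets[OF K(2) refl] borel_measurable_continuous_onI g_cont)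
      have "(\<lambda>k. \<integral>x. g k x \<partial>K) \<longlonglongrightarrow> (\<integral>x. indicator {..a} x \<partial>K)"
        using K(2) by (intro integral_dominated_convergence[where w = "\<lambda>_. 1"])
          (auto simp: g_lim m g_bd simp del: real_norm_def)
      moreover have "{..a} \<inter> space K = {..a}" using sets_eq_imp_space_eq[OF K(2)] by simp
      ultimately show ?thesis by (simp add: cdf_def)
    qed
    have "(\<lambda>k. \<integral>x. g k x \<partial>M) = (\<lambda>k. \<integral>x. g k x \<partial>N)"
      using integral_continuous_eq_if_moments_eq[OF M N moments g_cont] by simp
    with lim[OF M(1,2)] lim[OF N(1,2)] show "cdf M a = cdf N a"
      by (simp add: LIMSEQ_unique)
  qed
qed

text \<open>
  The one-dimensional result is applied to one coordinate at a time. With all other coordinates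
  frozen, either as powers or as indicators, the remaining powers of a single coordinate are the
  moments of a finite measure on \<open>[0, 1]\<close>, so they may be replaced by the indicator of a Borel set.
  The set \<open>Q\<close> collects the coordinates already replaced.
\<close>

lemma integral_cylinder_eq_if_mixed_moments_eq:
  fixes M N :: "'a measure" and f :: "'p \<Rightarrow> 'a \<Rightarrow> real"
  assumes fin: "finite_measure M" "finite_measure N" and sets: "sets N = sets M"
    and P: "finite P" and meas: "\<And>p. p \<in> P \<Longrightarrow> f p \<in> borel_measurable M"
    and bd: "\<And>p. p \<in> P \<Longrightarrow> AE x in M. f p x \<in> {0..1}" "\<And>p. p \<in> P \<Longrightarrow> AE x in N. f p x \<in> {0..1}"
    and moments: "\<And>n. (\<integral>x. (\<Prod>p\<in>P. f p x ^ n p) \<partial>M) = (\<integral>x. (\<Prod>p\<in>P. f p x ^ n p) \<partial>N)"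
    and Q: "Q \<subseteq> P" and B: "\<And>p. p \<in> Q \<Longrightarrow> B p \<in> sets borel"
  shows "(\<integral>x. (\<Prod>p\<in>Q. indicator (B p) (f p x)) * (\<Prod>p\<in>P - Q. f p x ^ n p) \<partial>M) =
         (\<integral>x. (\<Prod>p\<in>Q. indicator (B p) (f p x)) * (\<Prod>p\<in>P - Q. f p x ^ n p) \<partial>N)"
  using finite_subset[OF Q P] Q B
proof (induction Q arbitrary: n rule: finite_induct)
  case empty
  then show ?case using moments by simp
next
  case (insert q Q)
  then have q: "q \<in> P" "q \<notin> Q" "Q \<subseteq> P" "finite Q" and Bm: "\<And>p. p \<in> insert q Q \<Longrightarrow> B p \<in> sets borel" by auto
  \<comment> \<open>The frozen factors act as a density with values in \<open>[0, 1]\<close>; \<open>D\<close> is the law of the coordinate \<open>q\<close> under it.\<close>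
  define w where "w x = (\<Prod>p\<in>Q. indicator (B p) (f p x)) * (\<Prod>p\<in>P - insert q Q. f p x ^ n p)" for x
  have bd_all: "AE x in K. \<forall>p\<in>P. f p x \<in> {0..1}" if "K = M \<or> K = N" for K
    using that bd P by (auto intro!: AE_finite_allI)
  have w_bd: "AE x in K. 0 \<le> w x \<and> w x \<le> 1" if "K = M \<or> K = N" for K
    using bd_all[OF that]
  proof eventually_elim
    case (elim x)
    then have *: "0 \<le> (\<Prod>p\<in>P - insert q Q. f p x ^ n p)" "(\<Prod>p\<in>P - insert q Q. f p x ^ n p) \<le> 1"
      by (auto intro!: prod_nonneg prod_le_1 power_le_one)
    have **: "0 \<le> (\<Prod>p\<in>Q. indicator (B p) (f p x) :: real)" "(\<Prod>p\<in>Q. indicator (B p) (f p x) :: real) \<le> 1"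
      by (auto intro!: prod_nonneg prod_le_1 split: split_indicator)
    show ?case using * ** by (auto simp: w_def intro: mult_le_one)
  qed
  have measK: "g \<in> borel_measurable K" if "g \<in> borel_measurable M" "K = M \<or> K = N" for K and g :: "'a \<Rightarrow> real"
    using that measurable_cong_sets[OF sets refl, of "borel :: real measure"] by auto
  have fM[measurable]: "f p \<in> borel_measurable M" if "p \<in> P" for p
    using meas that .
  have ind[measurable]: "(\<lambda>x. indicator (B p) (f p x) :: real) \<in> borel_measurable M" if "p \<in> insert q Q" for p
  proof -
    have "B p \<in> sets borel" "p \<in> P" using that Bm q by auto
    then show ?thesis by measurable
  qed
  have wM: "w \<in> borel_measurable M"
    unfolding w_def using q by (intro borel_measurable_times borel_measurable_prod ind borel_measurable_power fM) auto
  define D where "D K = distr (density K (\<lambda>x. ennreal (w x))) borel (f q)" for K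
  have D_int: "(\<integral>y. h y \<partial>D K) = (\<integral>x. w x * h (f q x) \<partial>K)"
    if "K = M \<or> K = N" and h: "h \<in> borel_measurable borel" for K and h :: "real \<Rightarrow> real"
  proof -
    have [measurable]: "f q \<in> borel_measurable K" "w \<in> borel_measurable K"
      using measK[OF fM[OF q(1)] that(1)] measK[OF wM that(1)] by auto
    note h[measurable]
    have "(\<integral>y. h y \<partial>D K) = (\<integral>x. h (f q x) \<partial>density K (\<lambda>x. ennreal (w x)))"
      unfolding D_def by (intro integral_distr) auto
    also have "\<dots> = (\<integral>x. w x *\<^sub>R h (f q x) \<partial>K)"
      using w_bd[OF that(1)] by (intro integral_density) auto
    finally show ?thesis by simp
  qed
  have D_fin: "finite_measure (D K)" if "K = M \<or> K = N" for K
  proof -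
    have [measurable]: "f q \<in> borel_measurable K" "w \<in> borel_measurable K"
      using measK[OF fM[OF q(1)] that] measK[OF wM that] by auto
    have "emeasure (D K) (space (D K)) = (\<integral>\<^sup>+x. ennreal (w x) \<partial>K)"
      unfolding D_def by (subst emeasure_distr) (auto simp: emeasure_density intro!: nn_integral_cong)
    also have "\<dots> \<le> (\<integral>\<^sup>+x. 1 \<partial>K)"
      using w_bd[OF that] by (intro nn_integral_mono_AE) auto
    also have "\<dots> < \<infinity>"
      using that fin by (auto simp: finite_measure.emeasure_finite less_top[symmetric])
    finally show ?thesis by (intro finite_measureI) auto
  qed
  have D_AE: "AE y in D K. y \<in> {0..1}" if "K = M \<or> K = N" for K
  proof -
    have [measurable]: "f q \<in> borel_measurable K" "w \<in> borel_measurable K"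
      using measK[OF fM[OF q(1)] that] measK[OF wM that] by auto
    have "AE x in K. f q x \<in> {0..1}" using bd q that by auto
    then show ?thesis
      unfolding D_def by (subst AE_distr_iff) (auto simp: AE_density)
  qed
  have "D M = D N"
  proof (rule measure_eq_if_moments_eq)
    fix k
    have "(\<integral>x. w x * f q x ^ k \<partial>M) = (\<integral>x. w x * f q x ^ k \<partial>N)"
    proof -
      have "(\<Prod>p\<in>P - Q. f p x ^ (n(q := k)) p) = f q x ^ k * (\<Prod>p\<in>P - insert q Q. f p x ^ n p)" for x
      proof -
        have "(\<Prod>p\<in>P - Q. f p x ^ (n(q := k)) p) =
            f q x ^ k * (\<Prod>p\<in>P - Q - {q}. f p x ^ (n(q := k)) p)"
          using P q by (subst prod.remove[of _ q]) auto
        also have "(\<Prod>p\<in>P - Q - {q}. f p x ^ (n(q := k)) p) = (\<Prod>p\<in>P - insert q Q. f p x ^ n p)"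
          by (intro prod.cong) auto
        finally show ?thesis .
      qed
      then have "w x * f q x ^ k = (\<Prod>p\<in>Q. indicator (B p) (f p x)) * (\<Prod>p\<in>P - Q. f p x ^ (n(q := k)) p)" for x
        by (simp add: w_def)
      then show ?thesis using insert.IH[of "n(q := k)"] q Bm by simp
    qed
    then show "(\<integral>y. y ^ k \<partial>D M) = (\<integral>y. y ^ k \<partial>D N)"
      by (simp add: D_int)
  next
    show "finite_measure (D M)" "finite_measure (D N)" by (simp_all add: D_fin)
    show "AE y in D M. y \<in> {0..1}" "AE y in D N. y \<in> {0..1}" by (intro D_AE; simp)+
    show "sets (D M) = sets borel" "sets (D N) = sets borel" by (simp_all add: D_def)
  qed
  have D_ind: "(\<integral>x. w x * indicator (B q) (f q x) \<partial>K) = (\<integral>y. indicator (B q) y \<partial>D K)"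
    if "K = M \<or> K = N" for K
    using Bm that by (intro D_int[symmetric]) auto
  have "(\<integral>x. w x * indicator (B q) (f q x) \<partial>M) = (\<integral>x. w x * indicator (B q) (f q x) \<partial>N)"
    unfolding D_ind[of M, simplified] D_ind[of N, simplified] \<open>D M = D N\<close> ..
  moreover have "w x * indicator (B q) (f q x) =
     (\<Prod>p\<in>insert q Q. indicator (B p) (f p x)) * (\<Prod>p\<in>P - insert q Q. f p x ^ n p)" for x
    using q by (simp add: w_def mult_ac)
  ultimately show ?case by simp
qed

lemma distr_eq_if_mixed_moments_eq:
  fixes M N :: "'a measure" and f :: "'p \<Rightarrow> 'a \<Rightarrow> real"
  assumes fin: "finite_measure M" "finite_measure N" and sets: "sets N = sets M"
    and P: "finite P" and meas: "\<And>p. p \<in> P \<Longrightarrow> f p \<in> borel_measurable M"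
    and bd: "\<And>p. p \<in> P \<Longrightarrow> AE x in M. f p x \<in> {0..1}" "\<And>p. p \<in> P \<Longrightarrow> AE x in N. f p x \<in> {0..1}"
    and moments: "\<And>n. (\<integral>x. (\<Prod>p\<in>P. f p x ^ n p) \<partial>M) = (\<integral>x. (\<Prod>p\<in>P. f p x ^ n p) \<partial>N)"
  shows "distr M (\<Pi>\<^sub>M p\<in>P. borel) (\<lambda>x. \<lambda>p\<in>P. f p x) = distr N (\<Pi>\<^sub>M p\<in>P. borel) (\<lambda>x. \<lambda>p\<in>P. f p x)"
proof (rule measure_eqI_PiM_finite[OF P, where A = "\<lambda>_. \<Pi>\<^sub>E p\<in>P. UNIV"])
  interpret M: finite_measure M by fact
  let ?F = "\<lambda>x. \<lambda>p\<in>P. f p x"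
  have FM[measurable]: "?F \<in> measurable M (\<Pi>\<^sub>M p\<in>P. borel)"
    using meas by (intro measurable_restrict) auto
  have FN[measurable]: "?F \<in> measurable N (\<Pi>\<^sub>M p\<in>P. borel)"
    using FM by (simp add: measurable_cong_sets[OF sets refl])
  show "range (\<lambda>_::nat. \<Pi>\<^sub>E p\<in>P. UNIV) \<subseteq> prod_algebra P (\<lambda>_. borel)"
    using P by (auto intro!: prod_algebraI_finite)
  show "(\<Union>i::nat. \<Pi>\<^sub>E p\<in>P. UNIV) = space (Pi\<^sub>M P (\<lambda>_. borel))"
    by (auto simp: space_PiM)
  show "emeasure (distr M (\<Pi>\<^sub>M p\<in>P. borel) ?F) (\<Pi>\<^sub>E p\<in>P. UNIV) \<noteq> \<infinity>"
    using M.finite_measure_distr[OF FM] by (simp add: finite_measure.emeasure_finite)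
  fix B :: "'p \<Rightarrow> real set" assume B: "\<And>p. p \<in> P \<Longrightarrow> B p \<in> sets borel"
  have BP: "Pi\<^sub>E P B \<in> sets (\<Pi>\<^sub>M p\<in>P. borel)"
    using B P by (intro sets_PiM_I_finite) auto
  have rect: "emeasure (distr K (\<Pi>\<^sub>M p\<in>P. borel) ?F) (Pi\<^sub>E P B) =
      ennreal (\<integral>x. (\<Prod>p\<in>P. indicator (B p) (f p x)) \<partial>K)"
    if K: "finite_measure K" and F: "?F \<in> measurable K (\<Pi>\<^sub>M p\<in>P. borel)" for K
  proof -
    interpret K: finite_measure K by fact
    have "emeasure (distr K (\<Pi>\<^sub>M p\<in>P. borel) ?F) (Pi\<^sub>E P B) = emeasure K (?F -` Pi\<^sub>E P B \<inter> space K)"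
      by (rule emeasure_distr[OF F BP])
    also have "\<dots> = ennreal (\<integral>x. indicator (?F -` Pi\<^sub>E P B \<inter> space K) x \<partial>K)"
      by (simp add: K.emeasure_eq_measure Int_assoc)
    also have "(\<integral>x. indicator (?F -` Pi\<^sub>E P B \<inter> space K) x \<partial>K) =
        (\<integral>x. (\<Prod>p\<in>P. indicator (B p) (f p x)) \<partial>K :: real)"
    proof (intro Bochner_Integration.integral_cong refl)
      fix x assume x: "x \<in> space K"
      show "indicator (?F -` Pi\<^sub>E P B \<inter> space K) x = (\<Prod>p\<in>P. indicator (B p) (f p x) :: real)"
      proof (cases "\<forall>p\<in>P. f p x \<in> B p")
        case True
        then show ?thesis using x by (auto simp: indicator_def)
      next
        case False
        then have "(\<Prod>p\<in>P. indicator (B p) (f p x) :: real) = 0"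
          using P by (subst prod_zero_iff) (auto simp: indicator_def)
        moreover have "x \<notin> ?F -` Pi\<^sub>E P B" using False by (auto simp: PiE_iff)
        ultimately show ?thesis by simp
      qed
    qed
    finally show ?thesis .
  qed
  show "emeasure (distr M (\<Pi>\<^sub>M p\<in>P. borel) ?F) (Pi\<^sub>E P B) =
      emeasure (distr N (\<Pi>\<^sub>M p\<in>P. borel) ?F) (Pi\<^sub>E P B)"
    using integral_cylinder_eq_if_mixed_moments_eq[OF assms order_refl B]
    by (simp add: rect fin FM FN)
qed simp_all

section \<open>A Gaussian integral in triangular coordinates\<close>

text \<open>
  The factor \<open>exp (y\<^sup>2 / 2)\<close> cancels the exponential in the standard normal density. What remains is a
  multiple of the density of the normal law with mean \<open>- b / a\<close> and standard deviation
  \<open>1 / (\<surd>2 a)\<close>.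
\<close>

lemma nn_integral_std_normal_affine:
  fixes a b :: real
  assumes "a > 0"
  shows "(\<integral>\<^sup>+y. ennreal (exp (y\<^sup>2 / 2 - (a * y + b)\<^sup>2)) \<partial>density lborel std_normal_density) =
    ennreal (1 / (sqrt 2 * a))"
proof -
  let ?s = "1 / (sqrt 2 * a)"
  have eq: "std_normal_density y * exp (y\<^sup>2 / 2 - (a * y + b)\<^sup>2) = ?s * normal_density (- b / a) ?s y" for y
  proof -
    have "(y - - b / a)\<^sup>2 / (2 * ?s\<^sup>2) = (a * y + b)\<^sup>2"
      using assms by (simp add: field_simps power2_eq_square)
    moreover have "sqrt (2 * pi * ?s\<^sup>2) = sqrt (2 * pi) * ?s"
      using assms by (simp add: real_sqrt_mult real_sqrt_divide)
    ultimately show ?thesis using assms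
      by (simp add: normal_density_def exp_add[symmetric] exp_diff exp_minus field_simps)
  qed
  have "(\<integral>\<^sup>+y. ennreal (exp (y\<^sup>2 / 2 - (a * y + b)\<^sup>2)) \<partial>density lborel std_normal_density) =
      (\<integral>\<^sup>+y. ennreal (std_normal_density y) * ennreal (exp (y\<^sup>2 / 2 - (a * y + b)\<^sup>2)) \<partial>lborel)"
    by (subst nn_integral_density) auto
  also have "\<dots> = (\<integral>\<^sup>+y. ennreal ?s * ennreal (normal_density (- b / a) ?s y) \<partial>lborel)"
    using assms by (intro nn_integral_cong) (simp add: ennreal_mult'[symmetric] eq)
  also have "\<dots> = ennreal ?s * (\<integral>\<^sup>+y. ennreal (normal_density (- b / a) ?s y) \<partial>lborel)"
    by (rule nn_integral_cmult) auto
  also have "(\<integral>\<^sup>+y. ennreal (normal_density (- b / a) ?s y) \<partial>lborel) = 1"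
  proof -
    have "?s > 0" using assms by simp
    from prob_space.emeasure_space_1[OF prob_space_normal_density[OF this]]
    show ?thesis by (simp add: emeasure_density)
  qed
  finally show ?thesis by simp
qed

text \<open>
  A variable of maximal rank \<open>rk\<close> occurs in no square but its own, so it can be integrated out first;
  by translation invariance the result does not depend on the variables of lower rank.
\<close>

lemma nn_integral_gaussian_triangular:
  fixes a :: "'i \<Rightarrow> real" and c :: "'i \<Rightarrow> 'i \<Rightarrow> real" and rk :: "'i \<Rightarrow> nat"
  assumes "finite I" and "\<And>p. p \<in> I \<Longrightarrow> a p > 0"
  shows "(\<integral>\<^sup>+x. ennreal (\<Prod>p\<in>I. exp ((x p)\<^sup>2 / 2 -
        (a p * x p + (\<Sum>q | q \<in> I \<and> rk q < rk p. c p q * x q))\<^sup>2))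
      \<partial>(\<Pi>\<^sub>M p\<in>I. density lborel std_normal_density)) = ennreal (\<Prod>p\<in>I. 1 / (sqrt 2 * a p))"
  using assms
proof (induction I rule: finite_ranking_induct[where f = rk])
  case empty
  have "emeasure (\<Pi>\<^sub>M p\<in>({}::'i set). density lborel (\<lambda>x. ennreal (std_normal_density x))) {\<lambda>_. undefined} = 1"
    by (simp add: PiM_empty)
  then show ?case by (simp add: PiM_empty space_count_space)
next
  case (insert z S)
  show ?case
  proof (cases "z \<in> S")
    case True
    then show ?thesis using insert by (simp add: insert_absorb)
  next
    case False
    let ?N = "density lborel (\<lambda>x. ennreal (std_normal_density x))"
    interpret N: prob_space ?N by (rule prob_space_normal_density) simp
    interpret P: product_sigma_finite "\<lambda>_::'i. ?N" by unfold_locales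
    define h where "h T p x = exp ((x p)\<^sup>2 / 2 -
        (a p * x p + (\<Sum>q | q \<in> T \<and> rk q < rk p. c p q * x q))\<^sup>2)" for T p and x :: "'i \<Rightarrow> real"
    have h_nonneg: "0 \<le> h T p x" for T p x by (simp add: h_def)
    have meas: "h T p \<in> borel_measurable (\<Pi>\<^sub>M p\<in>T. ?N)" if "p \<in> T" for T p
    proof -
      have [measurable]: "(\<lambda>x. x q) \<in> borel_measurable (\<Pi>\<^sub>M p\<in>T. ?N)" if "q \<in> T" for q
      proof -
        have "(\<lambda>x. x q) \<in> measurable (\<Pi>\<^sub>M p\<in>T. ?N) ?N"
          using that by (rule measurable_component_singleton)
        then show ?thesis by simp
      qed
      have s: "(\<lambda>x. \<Sum>q | q \<in> T \<and> rk q < rk p. c p q * x q) \<in> borel_measurable (\<Pi>\<^sub>M p\<in>T. ?N)"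
        by (intro borel_measurable_sum) auto
      show ?thesis unfolding h_def using that s by measurable
    qed
    have "(\<integral>\<^sup>+x. ennreal (\<Prod>p\<in>insert z S. h (insert z S) p x) \<partial>(\<Pi>\<^sub>M p\<in>insert z S. ?N)) =
       (\<integral>\<^sup>+x. (\<integral>\<^sup>+y. ennreal (\<Prod>p\<in>insert z S. h (insert z S) p (x(z := y))) \<partial>?N) \<partial>(\<Pi>\<^sub>M p\<in>S. ?N))"
      using insert.hyps(1) False
      by (intro P.product_nn_integral_insert measurable_compose[OF _ measurable_ennreal]
          borel_measurable_prod meas)
    also have "\<dots> = (\<integral>\<^sup>+x. ennreal (\<Prod>p\<in>S. h S p x) * ennreal (1 / (sqrt 2 * a z)) \<partial>(\<Pi>\<^sub>M p\<in>S. ?N))"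
    proof (intro nn_integral_cong)
      fix x :: "'i \<Rightarrow> real"
      have lower: "h (insert z S) p (x(z := y)) = h S p x" if "p \<in> S" for p y
      proof -
        have "p \<noteq> z" using that False by auto
        have "{q. q \<in> insert z S \<and> rk q < rk p} = {q. q \<in> S \<and> rk q < rk p}"
          using insert.hyps(2)[OF that] by auto
        moreover have "(\<Sum>q | q \<in> S \<and> rk q < rk p. c p q * (x(z := y)) q) =
            (\<Sum>q | q \<in> S \<and> rk q < rk p. c p q * x q)"
          using False by (intro sum.cong) auto
        ultimately show ?thesis using \<open>p \<noteq> z\<close> by (simp add: h_def)
      qed
      define b where "b = (\<Sum>q | q \<in> insert z S \<and> rk q < rk z. c z q * x q)"
      have top: "h (insert z S) z (x(z := y)) = exp (y\<^sup>2 / 2 - (a z * y + b)\<^sup>2)" for y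
      proof -
        have "(\<Sum>q | q \<in> insert z S \<and> rk q < rk z. c z q * (x(z := y)) q) = b"
          unfolding b_def by (intro sum.cong) auto
        then show ?thesis by (simp add: h_def)
      qed
      have "(\<integral>\<^sup>+y. ennreal (\<Prod>p\<in>insert z S. h (insert z S) p (x(z := y))) \<partial>?N) =
          (\<integral>\<^sup>+y. ennreal (\<Prod>p\<in>S. h S p x) * ennreal (exp (y\<^sup>2 / 2 - (a z * y + b)\<^sup>2)) \<partial>?N)"
        using insert.hyps(1) False
        by (intro nn_integral_cong)
          (simp add: lower top ennreal_mult' prod_nonneg h_nonneg mult.commute[of "ennreal (exp _)"] cong: prod.cong)
      also have "\<dots> = ennreal (\<Prod>p\<in>S. h S p x) * ennreal (1 / (sqrt 2 * a z))"
        using insert.prems by (subst nn_integral_cmult) (auto simp: nn_integral_std_normal_affine)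
      finally show "(\<integral>\<^sup>+y. ennreal (\<Prod>p\<in>insert z S. h (insert z S) p (x(z := y))) \<partial>?N) =
          ennreal (\<Prod>p\<in>S. h S p x) * ennreal (1 / (sqrt 2 * a z))" .
    qed
    also have "\<dots> = (\<integral>\<^sup>+x. ennreal (\<Prod>p\<in>S. h S p x) \<partial>(\<Pi>\<^sub>M p\<in>S. ?N)) * ennreal (1 / (sqrt 2 * a z))"
      by (intro nn_integral_multc measurable_compose[OF _ measurable_ennreal]
          borel_measurable_prod meas)
    also have "(\<integral>\<^sup>+x. ennreal (\<Prod>p\<in>S. h S p x) \<partial>(\<Pi>\<^sub>M p\<in>S. ?N)) = ennreal (\<Prod>p\<in>S. 1 / (sqrt 2 * a p))"
      unfolding h_def using insert by simp
    also have "\<dots> * ennreal (1 / (sqrt 2 * a z)) = ennreal (\<Prod>p\<in>insert z S. 1 / (sqrt 2 * a p))"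
      using insert.hyps(1) insert.prems False by (subst ennreal_mult''[symmetric]) (auto simp: mult.commute less_imp_le)
    finally show ?thesis unfolding h_def .
  qed
qed

section \<open>Triangular factors and generalized powers\<close>

text \<open>
  Completing the square in the last variable leaves the Schur complement of the last diagonal entry,
  which is positive definite of size one less. Eliminating from the last variable upwards is what makes
  the factorization \<open>L\<^sup>T L\<close> with \<open>L\<close> lower triangular, rather than \<open>L L\<^sup>T\<close>.
\<close>

lemma reverse_cholesky:
  fixes a :: "nat \<Rightarrow> nat \<Rightarrow> real"
  assumes "\<And>i j. i < n \<Longrightarrow> j < n \<Longrightarrow> a i j = a j i"
    and "\<And>v. \<exists>i<n. v i \<noteq> 0 \<Longrightarrow> (\<Sum>i<n. \<Sum>j<n. a i j * v i * v j) > 0"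
  shows "\<exists>l. (\<forall>i<n. l i i > 0) \<and> (\<forall>i j. i < j \<longrightarrow> l i j = 0) \<and>
    (\<forall>i<n. \<forall>j<n. a i j = (\<Sum>k<n. l k i * l k j))"
  using assms
proof (induction n arbitrary: a)
  case 0
  show ?case by (intro exI[of _ "\<lambda>_ _. 0"]) auto
next
  case (Suc n)
  note sym = Suc.prems(1) and pos = Suc.prems(2)
  define \<alpha> where "\<alpha> = a n n"
  have "\<alpha> > 0"
  proof -
    have "(\<Sum>i<Suc n. \<Sum>j<Suc n. a i j * (if i = n then 1 else 0) * (if j = n then 1 else 0)) = \<alpha>"
      by (simp add: \<alpha>_def)
    with pos[of "\<lambda>i. if i = n then 1 else 0"] show ?thesis by auto
  qed
  define a' where "a' i j = a i j - a i n * a j n / \<alpha>" for i j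
  have "\<exists>l. (\<forall>i<n. l i i > 0) \<and> (\<forall>i j. i < j \<longrightarrow> l i j = 0) \<and>
    (\<forall>i<n. \<forall>j<n. a' i j = (\<Sum>k<n. l k i * l k j))"
  proof (rule Suc.IH)
    show "a' i j = a' j i" if "i < n" "j < n" for i j
      using sym[of i j] that by (simp add: a'_def mult.commute)
    fix v :: "nat \<Rightarrow> real" assume v: "\<exists>i<n. v i \<noteq> 0"
    define \<sigma> where "\<sigma> = (\<Sum>i<n. a i n * v i)"
    \<comment> \<open>The last coordinate that minimizes the quadratic form, given the others.\<close>
    define w where "w = v(n := - \<sigma> / \<alpha>)"
    have w: "w i = v i" if "i < n" for i using that by (simp add: w_def)
    have "\<exists>i<Suc n. w i \<noteq> 0" using v w by (metis less_SucI)
    then have "0 < (\<Sum>i<Suc n. \<Sum>j<Suc n. a i j * w i * w j)" by (rule pos)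
    also have "\<dots> = (\<Sum>i<n. \<Sum>j<n. a i j * v i * v j) + 2 * (w n * \<sigma>) + \<alpha> * (w n)\<^sup>2"
    proof -
      have "(\<Sum>j<n. a n j * w n * v j) = w n * \<sigma>"
        unfolding \<sigma>_def sum_distrib_left using sym[of n] by (intro sum.cong) auto
      moreover have "(\<Sum>i<n. a i n * v i * w n) = w n * \<sigma>"
        unfolding \<sigma>_def sum_distrib_left by (intro sum.cong) auto
      ultimately show ?thesis
        by (simp add: w sum.distrib \<alpha>_def power2_eq_square cong: sum.cong_simp)
    qed
    also have "\<dots> = (\<Sum>i<n. \<Sum>j<n. a i j * v i * v j) - \<sigma>\<^sup>2 / \<alpha>"
      using \<open>\<alpha> > 0\<close> by (simp add: w_def power2_eq_square field_simps)
    also have "\<sigma>\<^sup>2 / \<alpha> = (\<Sum>i<n. \<Sum>j<n. a i n * a j n / \<alpha> * v i * v j)"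
      unfolding \<sigma>_def power2_eq_square sum_product sum_divide_distrib
      by (intro sum.cong refl) simp
    finally show "0 < (\<Sum>i<n. \<Sum>j<n. a' i j * v i * v j)"
      by (simp add: a'_def left_diff_distrib sum_subtractf)
  qed
  then obtain l where l: "\<And>i. i < n \<Longrightarrow> l i i > 0" "\<And>i j. i < j \<Longrightarrow> l i j = 0"
    "\<And>i j. i < n \<Longrightarrow> j < n \<Longrightarrow> a' i j = (\<Sum>k<n. l k i * l k j)" by blast
  define l' where "l' i j = (if i = n then (if j \<le> n then a j n / sqrt \<alpha> else 0) else l i j)" for i j
  have l'_less: "l' k j = l k j" if "k < n" for k j using that by (simp add: l'_def)
  have last: "l' n i * l' n j = a i n * a j n / \<alpha>" if "i \<le> n" "j \<le> n" for i j
    using that \<open>\<alpha> > 0\<close> by (simp add: l'_def)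
  have "a i j = (\<Sum>k<Suc n. l' k i * l' k j)" if ij: "i < Suc n" "j < Suc n" for i j
  proof -
    have "(\<Sum>k<n. l k i * l k j) = a i j - a i n * a j n / \<alpha>"
    proof (cases "i < n \<and> j < n")
      case True
      then show ?thesis using l(3)[of i j] by (simp add: a'_def)
    next
      case False
      then have "(\<Sum>k<n. l k i * l k j) = 0"
        using ij l(2) by (intro sum.neutral ballI) (auto simp: less_Suc_eq)
      moreover have "a i j = a i n * a j n / \<alpha>"
        using False ij sym[of n j] \<open>\<alpha> > 0\<close> by (auto simp: less_Suc_eq \<alpha>_def)
      ultimately show ?thesis by simp
    qed
    then show ?thesis using ij last[of i j] by (simp add: l'_less)
  qed
  moreover have "l' i i > 0" if "i < Suc n" for i
    using that \<open>\<alpha> > 0\<close> l(1) by (auto simp: l'_def \<alpha>_def less_Suc_eq real_div_sqrt)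
  moreover have "l' i j = 0" if "i < j" for i j
    using that l(2) by (auto simp: l'_def)
  ultimately show ?case by (intro exI[of _ l']) blast
qed

lemma quadratic_form_eq_sum:
  fixes A :: "real mat"
  assumes "A \<in> carrier_mat r r" "v \<in> carrier_vec r"
  shows "scalar_prod v (A *\<^sub>v v) = (\<Sum>i<r. \<Sum>j<r. A $$ (i, j) * vec_index v i * vec_index v j)"
  using assms
  by (auto simp: scalar_prod_def sum_distrib_left atLeast0LessThan mult_ac intro!: sum.cong)

text \<open>
  Positive definiteness in coordinates, with vectors as functions on the natural numbers: this is the
  form in which sums over entries can be manipulated.
\<close>

lemma pos_def_matsI:
  assumes "A \<in> carrier_mat r r" "\<And>i j. i < r \<Longrightarrow> j < r \<Longrightarrow> A $$ (i, j) = A $$ (j, i)"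
    and "\<And>v. \<exists>i<r. v i \<noteq> 0 \<Longrightarrow> (\<Sum>i<r. \<Sum>j<r. A $$ (i, j) * v i * v j) > 0"
  shows "A \<in> pos_def_mats r"
proof -
  have "A \<in> sym_mats r"
    using assms(1,2) by (auto simp: sym_mats_def intro!: eq_matI)
  moreover have "scalar_prod v (A *\<^sub>v v) > 0" if v: "v \<in> carrier_vec r" "v \<noteq> 0\<^sub>v r" for v
  proof -
    have "\<exists>i<r. vec_index v i \<noteq> 0" using v by (auto intro!: eq_vecI)
    then show ?thesis using assms(1,3) v by (simp add: quadratic_form_eq_sum)
  qed
  ultimately show ?thesis by (simp add: pos_def_mats_def)
qed

lemma pos_def_matsD:
  assumes "A \<in> pos_def_mats r"
  shows "A \<in> carrier_mat r r" "\<And>i j. i < r \<Longrightarrow> j < r \<Longrightarrow> A $$ (i, j) = A $$ (j, i)"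
    and "\<And>v. \<exists>i<r. v i \<noteq> 0 \<Longrightarrow> (\<Sum>i<r. \<Sum>j<r. A $$ (i, j) * v i * v j) > 0"
proof -
  show A: "A \<in> carrier_mat r r" using assms by (auto simp: pos_def_mats_def sym_mats_def)
  show "A $$ (i, j) = A $$ (j, i)" if "i < r" "j < r" for i j
  proof -
    have "transpose_mat A = A" using assms by (auto simp: pos_def_mats_def sym_mats_def)
    then show ?thesis using A that by (metis carrier_matD index_transpose_mat(1))
  qed
  fix v :: "nat \<Rightarrow> real" assume "\<exists>i<r. v i \<noteq> 0"
  then have "vec r v \<noteq> 0\<^sub>v r" by (metis index_vec index_zero_vec(1))
  then have "scalar_prod (vec r v) (A *\<^sub>v vec r v) > 0"
    using assms by (simp add: pos_def_mats_def)
  then show "(\<Sum>i<r. \<Sum>j<r. A $$ (i, j) * v i * v j) > 0"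
    using A by (simp add: quadratic_form_eq_sum cong: sum.cong_simp)
qed

text \<open>
  The relation \<open>A = L\<^sup>T L\<close> with \<open>L\<close> lower triangular with positive diagonal. The factor is a function on
  pairs of indices, zero above the diagonal for all indices, so that blocks of \<open>L\<close> are restrictions of one
  function.
\<close>

definition triangular_factor :: "nat \<Rightarrow> (nat \<Rightarrow> nat \<Rightarrow> real) \<Rightarrow> real mat \<Rightarrow> bool" where
  "triangular_factor r l A \<longleftrightarrow> A \<in> carrier_mat r r \<and> (\<forall>i<r. l i i > 0) \<and> (\<forall>i j. i < j \<longrightarrow> l i j = 0) \<and>
    (\<forall>i<r. \<forall>j<r. A $$ (i, j) = (\<Sum>k<r. l k i * l k j))"

lemma pos_def_triangular_factor:
  assumes "A \<in> pos_def_mats r"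
  obtains l where "triangular_factor r l A"
  using reverse_cholesky[of r "\<lambda>i j. A $$ (i, j)"] pos_def_matsD[OF assms] assms
  unfolding triangular_factor_def by blast

lemma triangular_factor_mat:
  assumes "triangular_factor r l A"
  shows "A = transpose_mat (Matrix.mat r r (\<lambda>(i, j). l i j)) * Matrix.mat r r (\<lambda>(i, j). l i j)"
  using assms
  by (intro eq_matI) (auto simp: triangular_factor_def scalar_prod_def atLeast0LessThan)

lemma det_triangular:
  fixes l :: "nat \<Rightarrow> nat \<Rightarrow> real"
  assumes "\<And>i j. i < j \<Longrightarrow> l i j = 0"
  shows "Determinant.det (Matrix.mat k k (\<lambda>(i, j). l i j)) = (\<Prod>i<k. l i i)"
  using assms
  by (subst det_lower_triangular[of k]) (auto simp: prod_list_diag_prod atLeast0LessThan)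

lemma det_triangular_factor:
  assumes "triangular_factor r l A"
  shows "Determinant.det A = (\<Prod>i<r. (l i i)\<^sup>2)"
proof -
  let ?L = "Matrix.mat r r (\<lambda>(i, j). l i j)"
  have L: "?L \<in> carrier_mat r r" by simp
  have "Determinant.det A = Determinant.det (transpose_mat ?L) * Determinant.det ?L"
    by (subst triangular_factor_mat[OF assms], rule det_mult) auto
  also have "Determinant.det (transpose_mat ?L) = Determinant.det ?L"
    by (rule det_transpose[OF L])
  also have "Determinant.det ?L = (\<Prod>i<r. l i i)"
    using assms by (intro det_triangular) (auto simp: triangular_factor_def)
  finally show ?thesis by (simp add: prod.distrib power2_eq_square)
qed

lemma index_triple_product:
  fixes B C :: "real mat"
  assumes "B \<in> carrier_mat n n" "C \<in> carrier_mat n n" "i < n" "j < n"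
  shows "(B * C * transpose_mat B) $$ (i, j) = (\<Sum>b<n. \<Sum>a<n. B $$ (i, a) * C $$ (a, b) * B $$ (j, b))"
  using assms
  by (simp add: scalar_prod_def atLeast0LessThan sum_distrib_left mult.assoc, subst sum.swap, simp)

text \<open>
  From \<open>S L\<^sup>T L = 1\<close> one gets \<open>L S L\<^sup>T = 1\<close>. The first \<open>k\<close> rows of \<open>L\<close> vanish beyond column
  \<open>k\<close>, so the leading blocks of order \<open>k\<close> satisfy the same identity, and taking determinants gives the
  minor.
\<close>

lemma leading_minor_inverse:
  assumes fac: "triangular_factor r l A" and S: "S \<in> carrier_mat r r" "S * A = 1\<^sub>m r" and k: "k \<le> r"
  shows "leading_minor k S = (\<Prod>i<k. 1 / (l i i)\<^sup>2)"
proof -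
  let ?L = "\<lambda>n. Matrix.mat n n (\<lambda>(i, j). l i j)"
  let ?S = "Matrix.mat k k (\<lambda>p. S $$ p)"
  have tri: "\<And>i j. i < j \<Longrightarrow> l i j = 0" and pos: "\<And>i. i < r \<Longrightarrow> l i i > 0"
    using fac by (auto simp: triangular_factor_def)
  have L: "?L r \<in> carrier_mat r r" and LT: "transpose_mat (?L r) \<in> carrier_mat r r" by auto
  have "(S * transpose_mat (?L r)) * ?L r = S * A"
    unfolding triangular_factor_mat[OF fac] by (rule assoc_mult_mat[OF S(1) LT L])
  then have "?L r * (S * transpose_mat (?L r)) = 1\<^sub>m r"
    using S by (intro mat_mult_left_right_inverse[OF mult_carrier_mat[OF S(1) LT] L]) simp
  then have id: "?L r * S * transpose_mat (?L r) = 1\<^sub>m r"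
    using assoc_mult_mat[OF L S(1) LT] by simp
  have "?L k * ?S * transpose_mat (?L k) = 1\<^sub>m k"
  proof (intro eq_matI)
    fix i j assume "i < dim_row (1\<^sub>m k :: real mat)" "j < dim_col (1\<^sub>m k :: real mat)"
    then have ij: "i < k" "j < k" by auto
    have "(?L k * ?S * transpose_mat (?L k)) $$ (i, j) = (\<Sum>b<k. \<Sum>a<k. l i a * S $$ (a, b) * l j b)"
      using ij by (subst index_triple_product[of _ k]) auto
    also have "\<dots> = (\<Sum>b<k. \<Sum>a<r. l i a * S $$ (a, b) * l j b)"
      using ij k tri by (intro sum.cong refl sum.mono_neutral_left) auto
    also have "\<dots> = (\<Sum>b<r. \<Sum>a<r. l i a * S $$ (a, b) * l j b)"
      using ij k tri by (intro sum.mono_neutral_left) auto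
    also have "\<dots> = (?L r * S * transpose_mat (?L r)) $$ (i, j)"
      using ij k S(1) by (subst index_triple_product[of _ r]) auto
    also have "\<dots> = 1\<^sub>m k $$ (i, j)" using id ij k by simp
    finally show "(?L k * ?S * transpose_mat (?L k)) $$ (i, j) = 1\<^sub>m k $$ (i, j)" .
  qed auto
  then have "1 = Determinant.det (?L k * ?S * transpose_mat (?L k))" by simp
  also have "\<dots> = Determinant.det (?L k) * Determinant.det ?S * Determinant.det (transpose_mat (?L k))"
    using det_mult[of "?L k * ?S" k "transpose_mat (?L k)"] det_mult[of "?L k" k ?S]
      mult_carrier_mat[of "?L k" k k ?S k] by simp
  also have "Determinant.det (transpose_mat (?L k)) = Determinant.det (?L k)"
    by (rule det_transpose[of _ k]) simp
  also have "Determinant.det (?L k) = (\<Prod>i<k. l i i)"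
    by (rule det_triangular[OF tri])
  finally have "(\<Prod>i<k. (l i i)\<^sup>2) * leading_minor k S = 1"
    by (simp add: leading_minor_def prod.distrib power2_eq_square mult_ac)
  moreover have "(\<Prod>i<k. (l i i)\<^sup>2) \<noteq> 0"
  proof -
    have "l i i \<noteq> 0" if "i < k" for i using pos[of i] that k by simp
    then show ?thesis by simp
  qed
  ultimately show ?thesis by (simp add: prod_dividef field_simps)
qed

text \<open>
  The generalized power of a matrix whose leading minors are the partial products of the \<open>d\<^sub>i\<close>: the
  exponent of \<open>d\<^sub>i\<close> is the telescoping sum of the differences \<open>t\<^sub>k - t\<^sub>k\<^sub>+\<^sub>1\<close> over the minors that
  contain it.
\<close>

lemma prod_powr_telescope:
  fixes d :: "nat \<Rightarrow> real"
  assumes "\<And>i. i < r \<Longrightarrow> d i > 0"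
  shows "(\<Prod>k = 1..<r. (\<Prod>i<k. d i) powr (t k - t (k + 1))) * (\<Prod>i<r. d i) powr t r =
    (\<Prod>i<r. d i powr t (Suc i))"
  using assms
proof (induction r)
  case 0
  then show ?case by simp
next
  case (Suc r)
  have D: "(\<Prod>i<r. d i) > 0" "d r > 0"
    using Suc.prems by (auto intro!: prod_pos)
  show ?case
  proof (cases "r = 0")
    case True
    then show ?thesis by simp
  next
    case False
    then have "{1..<Suc r} = insert r {1..<r}" by auto
    then have "(\<Prod>k = 1..<Suc r. (\<Prod>i<k. d i) powr (t k - t (k + 1))) * (\<Prod>i<Suc r. d i) powr t (Suc r) =
      (\<Prod>k = 1..<r. (\<Prod>i<k. d i) powr (t k - t (k + 1))) *
      ((\<Prod>i<r. d i) powr (t r - t (Suc r)) * (\<Prod>i<r. d i) powr t (Suc r)) * d r powr t (Suc r)"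
      using D by (simp add: powr_mult)
    also have "(\<Prod>i<r. d i) powr (t r - t (Suc r)) * (\<Prod>i<r. d i) powr t (Suc r) = (\<Prod>i<r. d i) powr t r"
      by (simp add: powr_add[symmetric])
    finally show ?thesis using Suc by simp
  qed
qed

lemma gen_power_inverse:
  assumes "triangular_factor r l A" "S \<in> carrier_mat r r" "S * A = 1\<^sub>m r"
  shows "gen_power r t S = (\<Prod>i<r. (1 / (l i i)\<^sup>2) powr t (Suc i))"
proof -
  have "gen_power r t S = (\<Prod>k = 1..<r. (\<Prod>i<k. 1 / (l i i)\<^sup>2) powr (t k - t (k + 1))) *
      (\<Prod>i<r. 1 / (l i i)\<^sup>2) powr t r"
    unfolding gen_power_def using leading_minor_inverse[OF assms] by simp
  also have "\<dots> = (\<Prod>i<r. (1 / (l i i)\<^sup>2) powr t (Suc i))"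
    using assms(1) by (intro prod_powr_telescope) (auto simp: triangular_factor_def less_imp_neq[symmetric])
  finally show ?thesis .
qed

lemma mat_inv_inverse:
  assumes A: "A \<in> carrier_mat r r" and "Determinant.det A \<noteq> 0"
  shows "mat_inv A \<in> carrier_mat r r" "mat_inv A * A = 1\<^sub>m r"
proof -
  have "A \<in> Units (ring_mat TYPE(real) r ())"
    using assms by (rule det_non_zero_imp_unit)
  then obtain S where "mat_inverse A = Some S"
    using mat_inverse(1)[OF A, of "()"] by (cases "mat_inverse A") auto
  then show "mat_inv A \<in> carrier_mat r r" "mat_inv A * A = 1\<^sub>m r"
    using mat_inverse(2)[OF A] by (auto simp: mat_inv_def)
qed

lemma gen_power_mat_inv:
  assumes "triangular_factor r l A"
  shows "gen_power r t (mat_inv A) = (\<Prod>i<r. (1 / (l i i)\<^sup>2) powr t (Suc i))"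
proof -
  have "Determinant.det A \<noteq> 0"
    using assms by (subst det_triangular_factor[OF assms])
      (auto simp: triangular_factor_def less_imp_neq[symmetric])
  moreover have "A \<in> carrier_mat r r" using assms by (simp add: triangular_factor_def)
  ultimately show ?thesis by (intro gen_power_inverse[OF assms] mat_inv_inverse)
qed

lemma gen_power_uminus_mat_inv:
  assumes fac: "triangular_factor r l A"
  shows "gen_power r t (- mat_inv (- A)) = (\<Prod>i<r. (1 / (l i i)\<^sup>2) powr t (Suc i))"
proof -
  have A: "A \<in> carrier_mat r r" using fac by (simp add: triangular_factor_def)
  have "- A = (-1) \<cdot>\<^sub>m A" using A by (intro eq_matI) auto
  then have "Determinant.det (- A) = (-1) ^ r * Determinant.det A"
    using A by (simp add: det_smult)
  also have "\<dots> \<noteq> 0"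
    using fac by (subst det_triangular_factor[OF fac])
      (auto simp: triangular_factor_def less_imp_neq[symmetric])
  finally have inv: "mat_inv (- A) \<in> carrier_mat r r" "mat_inv (- A) * - A = 1\<^sub>m r"
    using mat_inv_inverse[of "- A" r] A by auto
  have "- mat_inv (- A) * A = 1\<^sub>m r"
    using inv A by simp
  then show ?thesis using inv(1) by (intro gen_power_inverse[OF fac]) auto
qed

section \<open>Symmetric matrices as a measurable space\<close>

lemma space_sym_borel [simp]: "space (sym_borel r) = sym_mats r"
  by (simp add: sym_borel_def)

lemma measurable_entries:
  "(\<lambda>x. \<lambda>p\<in>{..<r} \<times> {..<r}. x $$ p) \<in> measurable (sym_borel r) (\<Pi>\<^sub>M p\<in>{..<r} \<times> {..<r}. borel)"
  unfolding sym_borel_def by (rule measurable_vimage_algebra1) (auto simp: space_PiM)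

lemma measurable_entry:
  assumes "p \<in> {..<r} \<times> {..<r}"
  shows "(\<lambda>x. x $$ p) \<in> borel_measurable (sym_borel r)"
proof -
  have "(\<lambda>x. (\<lambda>p\<in>{..<r} \<times> {..<r}. x $$ p) p) \<in> borel_measurable (sym_borel r)"
    using measurable_entries measurable_component_singleton[OF assms] by (rule measurable_compose)
  then show ?thesis using assms by simp
qed

lemma measurable_sym_borelI:
  assumes "\<And>\<omega>. \<omega> \<in> space M \<Longrightarrow> X \<omega> \<in> sym_mats r"
    and "\<And>p. p \<in> {..<r} \<times> {..<r} \<Longrightarrow> (\<lambda>\<omega>. X \<omega> $$ p) \<in> borel_measurable M"
  shows "X \<in> measurable M (sym_borel r)"
  unfolding sym_borel_def
  using assms by (intro measurable_vimage_algebra2 measurable_restrict) auto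

lemma mat_inner_eq_sum:
  assumes "A \<in> carrier_mat r r" "x \<in> carrier_mat r r"
  shows "mat_inner A x = (\<Sum>i<r. \<Sum>j<r. A $$ (i, j) * x $$ (j, i))"
  using assms by (simp add: mat_inner_def scalar_prod_def atLeast0LessThan)

lemma sym_matsD:
  assumes "x \<in> sym_mats r"
  shows "x \<in> carrier_mat r r" "i < r \<Longrightarrow> j < r \<Longrightarrow> x $$ (i, j) = x $$ (j, i)"
proof -
  show x: "x \<in> carrier_mat r r" using assms by (simp add: sym_mats_def)
  assume "i < r" "j < r"
  moreover have "transpose_mat x = x" using assms by (simp add: sym_mats_def)
  ultimately show "x $$ (i, j) = x $$ (j, i)"
    using x by (metis carrier_matD index_transpose_mat(1))
qed

lemma mat_inner_scale:
  assumes "A \<in> carrier_mat r r" "x \<in> carrier_mat r r"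
  shows "mat_inner (c \<cdot>\<^sub>m A) x = c * mat_inner A x"
  using assms by (simp add: mat_inner_eq_sum[of _ r] sum_distrib_left mult.assoc)

lemma mat_inner_uminus:
  assumes "A \<in> carrier_mat r r" "x \<in> carrier_mat r r"
  shows "mat_inner (- A) x = - mat_inner A x"
  using assms by (simp add: mat_inner_eq_sum[of _ r] sum_negf)

lemma measurable_mat_inner:
  assumes "A \<in> carrier_mat r r"
  shows "mat_inner A \<in> borel_measurable (sym_borel r)"
proof -
  have "(\<lambda>x. \<Sum>i<r. \<Sum>j<r. A $$ (i, j) * x $$ (j, i)) \<in> borel_measurable (sym_borel r)"
    by (intro borel_measurable_sum borel_measurable_times borel_measurable_const measurable_entry) auto
  then show ?thesis
    using assms sym_matsD(1) by (subst measurable_cong) (auto simp: mat_inner_eq_sum[of _ r])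
qed

lemma pos_def_mats_scale:
  assumes "A \<in> pos_def_mats r" "c > 0"
  shows "c \<cdot>\<^sub>m A \<in> pos_def_mats r"
proof (rule pos_def_matsI)
  note A = pos_def_matsD[OF assms(1)]
  show "c \<cdot>\<^sub>m A \<in> carrier_mat r r" using A by simp
  show "(c \<cdot>\<^sub>m A) $$ (i, j) = (c \<cdot>\<^sub>m A) $$ (j, i)" if "i < r" "j < r" for i j
    using A(1) A(2)[OF that] that by simp
  fix v :: "nat \<Rightarrow> real" assume "\<exists>i<r. v i \<noteq> 0"
  then have "0 < c * (\<Sum>i<r. \<Sum>j<r. A $$ (i, j) * v i * v j)" using A(3) assms(2) by simp
  also have "\<dots> = (\<Sum>i<r. \<Sum>j<r. (c \<cdot>\<^sub>m A) $$ (i, j) * v i * v j)"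
    using A(1) by (simp add: sum_distrib_left mult.assoc)
  finally show "0 < (\<Sum>i<r. \<Sum>j<r. (c \<cdot>\<^sub>m A) $$ (i, j) * v i * v j)" .
qed

text \<open>
  The matrix \<open>a I + C + C\<^sup>T\<close>. These matrices are closed under addition, span the symmetric matrices, and are
  positive definite once \<open>a\<close> dominates the entries of \<open>C\<close>.
\<close>

definition perturbed_identity :: "nat \<Rightarrow> real \<Rightarrow> (nat \<times> nat \<Rightarrow> real) \<Rightarrow> real mat" where
  "perturbed_identity r a c =
     Matrix.mat r r (\<lambda>(i, j). (if i = j then a else 0) + c (i, j) + c (j, i))"

text \<open>
  Each product \<open>v\<^sub>i v\<^sub>j\<close> is at least \<open>- \<bar>v\<bar>\<^sup>2\<close>, so the perturbation lowers the quadratic form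
  \<open>a \<bar>v\<bar>\<^sup>2\<close> by at most twice the sum of the entries of \<open>C\<close> times \<open>\<bar>v\<bar>\<^sup>2\<close>.
\<close>

lemma perturbed_identity_pos_def:
  assumes c: "\<And>p. c p \<ge> 0" and a: "a > 2 * (\<Sum>p\<in>{..<r} \<times> {..<r}. c p)"
  shows "perturbed_identity r a c \<in> pos_def_mats r"
proof (rule pos_def_matsI)
  let ?A = "perturbed_identity r a c"
  show "?A \<in> carrier_mat r r" by (simp add: perturbed_identity_def)
  show "?A $$ (i, j) = ?A $$ (j, i)" if "i < r" "j < r" for i j
    using that by (simp add: perturbed_identity_def)
  fix v :: "nat \<Rightarrow> real" assume "\<exists>i<r. v i \<noteq> 0"
  then obtain k where k: "k < r" "v k \<noteq> 0" by blast
  define S where "S = (\<Sum>i<r. (v i)\<^sup>2)"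
  have le_S: "(v i)\<^sup>2 \<le> S" if "i < r" for i
    unfolding S_def using that by (intro member_le_sum) auto
  have "S > 0" using le_S[OF k(1)] k(2) by (smt (verit) zero_less_power2)
  have "- S \<le> v i * v j" if "i < r" "j < r" for i j
  proof -
    have "0 \<le> (v i + v j)\<^sup>2" by simp
    then show ?thesis using le_S[OF that(1)] le_S[OF that(2)] by (simp add: power2_sum)
  qed
  then have "(\<Sum>p\<in>{..<r} \<times> {..<r}. c p * - S) \<le> (\<Sum>p\<in>{..<r} \<times> {..<r}. c p * (v (fst p) * v (snd p)))"
    using c by (intro sum_mono mult_left_mono) auto
  also have "\<dots> = (\<Sum>i<r. \<Sum>j<r. c (i, j) * (v i * v j))"
    by (simp add: sum.cartesian_product case_prod_beta)
  finally have lower: "- (\<Sum>p\<in>{..<r} \<times> {..<r}. c p) * S \<le> (\<Sum>i<r. \<Sum>j<r. c (i, j) * (v i * v j))"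
    by (simp add: sum_distrib_right sum_negf)
  have "(\<Sum>i<r. \<Sum>j<r. ?A $$ (i, j) * v i * v j) =
      (\<Sum>i<r. \<Sum>j<r. (if i = j then a * (v i * v j) else 0)) +
      (\<Sum>i<r. \<Sum>j<r. c (i, j) * (v i * v j)) + (\<Sum>i<r. \<Sum>j<r. c (j, i) * (v i * v j))"
    unfolding sum.distrib[symmetric]
    by (intro sum.cong refl) (auto simp: perturbed_identity_def algebra_simps)
  also have "(\<Sum>i<r. \<Sum>j<r. c (j, i) * (v i * v j)) = (\<Sum>i<r. \<Sum>j<r. c (i, j) * (v i * v j))"
    by (subst sum.swap) (simp add: mult.commute)
  also have "(\<Sum>i<r. \<Sum>j<r. (if i = j then a * (v i * v j) else 0)) = a * S"
    by (simp add: S_def sum_distrib_left power2_eq_square cong: sum.cong_simp)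
  finally have "(\<Sum>i<r. \<Sum>j<r. ?A $$ (i, j) * v i * v j) =
      a * S + 2 * (\<Sum>i<r. \<Sum>j<r. c (i, j) * (v i * v j))" by simp
  moreover have "(a - 2 * (\<Sum>p\<in>{..<r} \<times> {..<r}. c p)) * S > 0"
    using a \<open>S > 0\<close> by simp
  ultimately show "0 < (\<Sum>i<r. \<Sum>j<r. ?A $$ (i, j) * v i * v j)"
    using lower by (simp add: left_diff_distrib)
qed

lemma mat_inner_perturbed_identity:
  assumes x: "x \<in> sym_mats r"
  shows "mat_inner (perturbed_identity r a c) x =
    a * (\<Sum>i<r. x $$ (i, i)) + 2 * (\<Sum>p\<in>{..<r} \<times> {..<r}. c p * x $$ p)"
proof -
  have sym: "x $$ (i, j) = x $$ (j, i)" if "i < r" "j < r" for i j using sym_matsD(2)[OF x that] .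
  have "mat_inner (perturbed_identity r a c) x =
      (\<Sum>i<r. \<Sum>j<r. perturbed_identity r a c $$ (i, j) * x $$ (j, i))"
    using sym_matsD(1)[OF x] by (intro mat_inner_eq_sum) (auto simp: perturbed_identity_def)
  also have "\<dots> = (\<Sum>i<r. \<Sum>j<r. (if i = j then a * x $$ (i, j) else 0)) +
      (\<Sum>i<r. \<Sum>j<r. c (i, j) * x $$ (i, j)) + (\<Sum>i<r. \<Sum>j<r. c (j, i) * x $$ (j, i))"
    unfolding sum.distrib[symmetric]
    by (intro sum.cong refl) (auto simp: perturbed_identity_def algebra_simps sym)
  also have "(\<Sum>i<r. \<Sum>j<r. c (j, i) * x $$ (j, i)) = (\<Sum>i<r. \<Sum>j<r. c (i, j) * x $$ (i, j))"
    by (rule sum.swap)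
  also have "(\<Sum>i<r. \<Sum>j<r. c (i, j) * x $$ (i, j)) = (\<Sum>p\<in>{..<r} \<times> {..<r}. c p * x $$ p)"
    by (simp add: sum.cartesian_product case_prod_beta)
  also have "(\<Sum>i<r. \<Sum>j<r. (if i = j then a * x $$ (i, j) else 0)) = a * (\<Sum>i<r. x $$ (i, i))"
    by (simp add: sum_distrib_left cong: sum.cong_simp)
  finally show ?thesis by simp
qed

section \<open>Injectivity of the Laplace transform\<close>

text \<open>
  On the set where \<open>\<langle>A, x\<rangle> < 0\<close> the integrand \<open>exp (- k \<langle>A, x\<rangle>)\<close> increases to infinity with \<open>k\<close>. By
  monotone convergence, bounded integrals force that set to be null.
\<close>

lemma AE_mat_inner_nonneg:
  assumes sets: "sets \<nu> = sets (sym_borel r)" and A: "A \<in> carrier_mat r r" and "C < \<infinity>"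
    and bound: "\<And>k. laplace \<nu> (- (real (Suc k) \<cdot>\<^sub>m A)) \<le> C"
  shows "AE x in \<nu>. mat_inner A x \<ge> 0"
proof -
  have sp: "space \<nu> = sym_mats r" using sets_eq_imp_space_eq[OF sets] by simp
  have meas[measurable]: "mat_inner A \<in> borel_measurable \<nu>"
    using measurable_mat_inner[OF A] by (simp add: measurable_cong_sets[OF sets refl])
  have inner: "mat_inner (- (real (Suc k) \<cdot>\<^sub>m A)) x = - (real (Suc k) * mat_inner A x)"
    if "x \<in> space \<nu>" for k x
    using that A sp sym_matsD(1)[of x r]
    by (simp only: mat_inner_uminus[of _ r] mat_inner_scale smult_carrier_mat)
  define h where "h k x = (if mat_inner A x < 0 then ennreal (exp (- (real (Suc k) * mat_inner A x))) else 0)" for k x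
  have h_meas: "h k \<in> borel_measurable \<nu>" for k unfolding h_def by measurable
  have "incseq h"
  proof (intro incseq_SucI le_funI)
    fix k x
    show "h k x \<le> h (Suc k) x"
      by (auto simp: h_def intro!: ennreal_leI mult_right_mono_neg)
  qed
  have "(\<integral>\<^sup>+x. (SUP k. h k x) \<partial>\<nu>) = (SUP k. (\<integral>\<^sup>+x. h k x \<partial>\<nu>))"
    using \<open>incseq h\<close> h_meas by (rule nn_integral_monotone_convergence_SUP)
  also have "\<dots> \<le> C"
  proof (rule SUP_least)
    fix k
    have "(\<integral>\<^sup>+x. h k x \<partial>\<nu>) \<le> laplace \<nu> (- (real (Suc k) \<cdot>\<^sub>m A))"
      unfolding laplace_def using inner[of _ k] by (intro nn_integral_mono) (auto simp: h_def)
    then show "(\<integral>\<^sup>+x. h k x \<partial>\<nu>) \<le> C" using bound[of k] by (rule order_trans)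
  qed
  finally have "(\<integral>\<^sup>+x. (SUP k. h k x) \<partial>\<nu>) \<noteq> \<infinity>" using \<open>C < \<infinity>\<close> by (auto simp: top_unique)
  then have "AE x in \<nu>. (SUP k. h k x) \<noteq> \<infinity>"
    using h_meas by (intro nn_integral_PInf_AE) auto
  then show ?thesis
  proof eventually_elim
    case (elim x)
    show ?case
    proof (rule ccontr)
      assume "\<not> 0 \<le> mat_inner A x"
      then have neg: "mat_inner A x < 0" by simp
      from elim obtain b where b: "(SUP k. h k x) = ennreal b" "b \<ge> 0"
        by (cases "SUP k. h k x") auto
      obtain k :: nat where k: "real k * - mat_inner A x > b"
        using reals_Archimedean3[of "- mat_inner A x"] neg by auto
      have "ennreal (exp (- (real (Suc k) * mat_inner A x))) \<le> ennreal b"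
        unfolding b(1)[symmetric] using neg by (intro SUP_upper2[of k]) (auto simp: h_def)
      then have "exp (- (real (Suc k) * mat_inner A x)) \<le> b" using b(2) by simp
      moreover have "b < exp (- (real (Suc k) * mat_inner A x))"
        using k neg exp_ge_add_one_self[of "- (real (Suc k) * mat_inner A x)"] by (simp add: algebra_simps)
      ultimately show False by simp
    qed
  qed
qed

text \<open>
  The Borel sets of symmetric matrices are generated by the entries, so a measure is determined by its
  image under any map \<open>F\<close> from which the entries can be recovered measurably.
\<close>

lemma measure_eq_if_distr_eq:
  assumes sets: "sets \<mu> = sets (sym_borel r)" "sets \<nu> = sets (sym_borel r)"
    and F: "F \<in> measurable (sym_borel r) K"
    and h: "h \<in> measurable K (\<Pi>\<^sub>M p\<in>{..<r} \<times> {..<r}. borel)"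
    and hF: "\<And>x. x \<in> sym_mats r \<Longrightarrow> h (F x) = (\<lambda>p\<in>{..<r} \<times> {..<r}. x $$ p)"
    and eq: "distr \<mu> K F = distr \<nu> K F"
  shows "\<mu> = \<nu>"
proof (rule measure_eqI)
  show "sets \<mu> = sets \<nu>" using sets by simp
  fix S assume "S \<in> sets \<mu>"
  let ?e = "\<lambda>x. \<lambda>p\<in>{..<r} \<times> {..<r}. x $$ p"
  have "S \<in> {?e -` B \<inter> sym_mats r | B. B \<in> sets (\<Pi>\<^sub>M p\<in>{..<r} \<times> {..<r}. borel)}"
  proof -
    have "?e \<in> sym_mats r \<rightarrow> space (\<Pi>\<^sub>M p\<in>{..<r} \<times> {..<r}. (borel :: real measure))"
      by (auto simp: space_PiM)
    from sets_vimage_algebra2[OF this] show ?thesis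
      using \<open>S \<in> sets \<mu>\<close> sets(1) unfolding sym_borel_def by simp
  qed
  then obtain B where B: "B \<in> sets (\<Pi>\<^sub>M p\<in>{..<r} \<times> {..<r}. borel)" "S = ?e -` B \<inter> sym_mats r"
    by blast
  define B' where "B' = h -` B \<inter> space K"
  have B'K: "B' \<in> sets K" unfolding B'_def using h B(1) by (rule measurable_sets)
  have S: "S = F -` B' \<inter> sym_mats r"
    using hF measurable_space[OF F] by (auto simp: B(2) B'_def)
  have "emeasure \<kappa> S = emeasure (distr \<kappa> K F) B'" if "sets \<kappa> = sets (sym_borel r)" for \<kappa>
  proof -
    have "F \<in> measurable \<kappa> K" using F by (simp add: measurable_cong_sets[OF that refl])
    then show ?thesis
      using B'K S sets_eq_imp_space_eq[OF that] by (simp add: emeasure_distr)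
  qed
  then show "emeasure \<mu> S = emeasure \<nu> S" using sets eq by simp
qed

text \<open>
  Nonnegativity of the \<open>\<langle>A, x\<rangle>\<close> is assumed for \<open>\<mu>\<close> and inherited by \<open>\<nu>\<close>. The measures themselves may be
  infinite, so they are compared after multiplication by the density \<open>exp (- tr x)\<close>; the moments of the
  tilted measures in the coordinates \<open>f p\<close> are values of the Laplace transform at \<open>- T n\<close>.
\<close>

theorem laplace_injective:
  assumes sets: "sets \<mu> = sets (sym_borel r)" "sets \<nu> = sets (sym_borel r)"
    and fin: "\<And>A. A \<in> pos_def_mats r \<Longrightarrow> laplace \<mu> (- A) < \<infinity>"
    and eq: "\<And>A. A \<in> pos_def_mats r \<Longrightarrow> laplace \<nu> (- A) = laplace \<mu> (- A)"
    and nonneg: "\<And>A. A \<in> pos_def_mats r \<Longrightarrow> AE x in \<mu>. mat_inner A x \<ge> 0"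
  shows "\<mu> = \<nu>"
proof -
  let ?P = "{..<r} \<times> {..<r}"
  have sp: "space \<mu> = sym_mats r" "space \<nu> = sym_mats r"
    using sets_eq_imp_space_eq[OF sets(1)] sets_eq_imp_space_eq[OF sets(2)] by auto
  have carr: "A \<in> carrier_mat r r" if "A \<in> pos_def_mats r" for A using pos_def_matsD(1)[OF that] .
  have nonneg': "AE x in \<nu>. mat_inner A x \<ge> 0" if A: "A \<in> pos_def_mats r" for A
  proof (rule AE_mat_inner_nonneg[OF sets(2) carr[OF A] fin[OF A]])
    fix k
    have "laplace \<nu> (- (real (Suc k) \<cdot>\<^sub>m A)) = laplace \<mu> (- (real (Suc k) \<cdot>\<^sub>m A))"
      using A by (intro eq pos_def_mats_scale) auto
    also have "\<dots> \<le> laplace \<mu> (- A)"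
      unfolding laplace_def
    proof (intro nn_integral_mono_AE)
      show "AE x in \<mu>. ennreal (exp (mat_inner (- (real (Suc k) \<cdot>\<^sub>m A)) x)) \<le> ennreal (exp (mat_inner (- A) x))"
        using nonneg[OF A] AE_space
      proof eventually_elim
        case (elim x)
        then have x: "x \<in> carrier_mat r r" using sp sym_matsD(1) by auto
        have "mat_inner (- (real (Suc k) \<cdot>\<^sub>m A)) x = - (real (Suc k) * mat_inner A x)"
          using carr[OF A] x by (simp only: mat_inner_uminus[of _ r] mat_inner_scale smult_carrier_mat)
        also have "\<dots> \<le> mat_inner (- A) x"
          using elim carr[OF A] x by (simp add: mat_inner_uminus[of _ r] algebra_simps)
        finally show ?case by (intro ennreal_leI) simp
      qed
    qed
    finally show "laplace \<nu> (- (real (Suc k) \<cdot>\<^sub>m A)) \<le> laplace \<mu> (- A)" .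
  qed
  define tr where "tr x = (\<Sum>i<r. x $$ (i, i))" for x :: "real mat"
  \<comment> \<open>The exponent is \<open>- \<langle>A, x\<rangle>\<close> for \<open>A = 3 I + E + E\<^sup>T\<close>, where \<open>E\<close> is the matrix unit at \<open>p\<close>; the coefficient 3 makes \<open>A\<close> positive definite.\<close>
  define f where "f p x = exp (- (3 * tr x + 2 * x $$ p))" for p and x :: "real mat"
  \<comment> \<open>The matrix that represents the tilt together with the powers \<open>n p\<close> of the coordinates \<open>f p\<close>.\<close>
  define T where "T n = perturbed_identity r (1 + 3 * (\<Sum>p\<in>?P. real (n p))) (\<lambda>p. real (n p))" for n
  have T: "T n \<in> pos_def_mats r" for n
    using sum_nonneg[of ?P "\<lambda>p. real (n p)"] unfolding T_def
    by (intro perturbed_identity_pos_def) linarith+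
  have tr_meas: "tr \<in> borel_measurable (sym_borel r)"
    unfolding tr_def by (intro borel_measurable_sum measurable_entry) auto
  have f_meas: "f p \<in> borel_measurable (sym_borel r)" if "p \<in> ?P" for p
  proof -
    note [measurable] = tr_meas measurable_entry[OF that]
    show ?thesis unfolding f_def by measurable
  qed
  have exp_T: "exp (- tr x) * (\<Prod>p\<in>?P. f p x ^ n p) = exp (mat_inner (- T n) x)" if "x \<in> sym_mats r" for x n
  proof -
    have "mat_inner (T n) x = tr x + (\<Sum>p\<in>?P. real (n p) * (3 * tr x + 2 * x $$ p))"
      unfolding T_def mat_inner_perturbed_identity[OF that] tr_def[symmetric]
      by (simp add: distrib_left sum.distrib sum_distrib_left sum_distrib_right algebra_simps)
    moreover have "(\<Prod>p\<in>?P. f p x ^ n p) = exp (- (\<Sum>p\<in>?P. real (n p) * (3 * tr x + 2 * x $$ p)))"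
      by (simp add: f_def exp_of_nat_mult[symmetric] exp_sum[symmetric] sum_negf[symmetric] del: minus_add_distrib)
    moreover have "mat_inner (- T n) x = - mat_inner (T n) x"
      using carr[OF T] sym_matsD(1)[OF that] by (rule mat_inner_uminus)
    ultimately show ?thesis by (simp add: exp_add[symmetric])
  qed
  define tilt where "tilt \<kappa> = density \<kappa> (\<lambda>x. ennreal (exp (- tr x)))" for \<kappa> :: "real mat measure"
  have tilt_sets: "sets (tilt \<mu>) = sets (sym_borel r)" "sets (tilt \<nu>) = sets (sym_borel r)"
    using sets by (simp_all add: tilt_def)
  have tr_meas': "(\<lambda>x. ennreal (exp (- tr x))) \<in> borel_measurable \<kappa>" if "sets \<kappa> = sets (sym_borel r)" for \<kappa>
    using tr_meas by (auto simp: measurable_cong_sets[OF that refl])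
  have prod_meas: "(\<lambda>x. \<Prod>p\<in>?P. f p x ^ n p) \<in> borel_measurable \<kappa>" if "sets \<kappa> = sets (sym_borel r)" for \<kappa> n
    using f_meas by (auto simp: measurable_cong_sets[OF that refl] intro!: borel_measurable_prod borel_measurable_power)
  have tilt_moment: "(\<integral>\<^sup>+x. ennreal (\<Prod>p\<in>?P. f p x ^ n p) \<partial>tilt \<kappa>) = laplace \<kappa> (- T n)"
    if "sets \<kappa> = sets (sym_borel r)" for \<kappa> n
  proof -
    have "(\<integral>\<^sup>+x. ennreal (\<Prod>p\<in>?P. f p x ^ n p) \<partial>tilt \<kappa>) =
        (\<integral>\<^sup>+x. ennreal (exp (- tr x)) * ennreal (\<Prod>p\<in>?P. f p x ^ n p) \<partial>\<kappa>)"
      unfolding tilt_def using tr_meas'[OF that] measurable_compose[OF prod_meas[OF that] measurable_ennreal]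
      by (rule nn_integral_density)
    also have "\<dots> = laplace \<kappa> (- T n)"
      unfolding laplace_def using sets_eq_imp_space_eq[OF that]
      by (intro nn_integral_cong) (simp add: ennreal_mult'[symmetric] exp_T)
    finally show ?thesis .
  qed
  have lap: "laplace \<mu> (- T n) < \<infinity>" "laplace \<nu> (- T n) = laplace \<mu> (- T n)" for n
    using fin[OF T] eq[OF T] by auto
  have tilt_fin: "finite_measure (tilt \<kappa>)" if "\<kappa> = \<mu> \<or> \<kappa> = \<nu>" for \<kappa>
  proof (rule finite_measureI)
    have "emeasure (tilt \<kappa>) (space (tilt \<kappa>)) = (\<integral>\<^sup>+x. ennreal (\<Prod>p\<in>?P. f p x ^ 0) \<partial>tilt \<kappa>)"
      by simp
    also have "\<dots> = laplace \<kappa> (- T (\<lambda>_. 0))"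
      using that sets tilt_moment[of \<kappa> "\<lambda>_. 0"] by auto
    also have "\<dots> < \<infinity>" using that lap[of "\<lambda>_. 0"] by auto
    finally show "emeasure (tilt \<kappa>) (space (tilt \<kappa>)) \<noteq> \<infinity>" by simp
  qed
  have f_le: "AE x in tilt \<kappa>. f p x \<in> {0..1}" if "p \<in> ?P" and \<kappa>: "\<kappa> = \<mu> \<or> \<kappa> = \<nu>" for p \<kappa>
  proof -
    let ?A = "perturbed_identity r 3 (\<lambda>q. of_bool (q = p))"
    have A: "?A \<in> pos_def_mats r"
      using that by (intro perturbed_identity_pos_def) (auto simp: of_bool_def)
    have \<kappa>s: "sets \<kappa> = sets (sym_borel r)" using \<kappa> sets by auto
    have "AE x in \<kappa>. mat_inner ?A x \<ge> 0" using \<kappa> nonneg[OF A] nonneg'[OF A] by auto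
    then have "AE x in \<kappa>. f p x \<in> {0..1}"
      using AE_space
    proof eventually_elim
      case (elim x)
      then have "x \<in> sym_mats r" using sp \<kappa> by auto
      then have "mat_inner ?A x = 3 * tr x + 2 * x $$ p"
        using that(1) by (simp add: mat_inner_perturbed_identity tr_def of_bool_def if_distrib[of "\<lambda>c. c * _"] cong: if_cong)
      then show ?case using elim by (simp add: f_def)
    qed
    then show ?thesis unfolding tilt_def using tr_meas'[OF \<kappa>s] by (subst AE_density) auto
  qed
  let ?K = "\<Pi>\<^sub>M p\<in>?P. (borel :: real measure)"
  have "distr (tilt \<mu>) ?K (\<lambda>x. \<lambda>p\<in>?P. f p x) = distr (tilt \<nu>) ?K (\<lambda>x. \<lambda>p\<in>?P. f p x)"
  proof (rule distr_eq_if_mixed_moments_eq)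
    show "f p \<in> borel_measurable (tilt \<mu>)" if "p \<in> ?P" for p
      using f_meas[OF that] by (simp add: measurable_cong_sets[OF tilt_sets(1) refl])
    fix n
    have "(\<integral>x. (\<Prod>p\<in>?P. f p x ^ n p) \<partial>tilt \<kappa>) = enn2real (laplace \<mu> (- T n))" if "\<kappa> = \<mu> \<or> \<kappa> = \<nu>" for \<kappa>
    proof -
      have "sets \<kappa> = sets (sym_borel r)" "sets (tilt \<kappa>) = sets (sym_borel r)"
        using that sets tilt_sets by auto
      moreover have "0 \<le> (\<Prod>p\<in>?P. f p x ^ n p)" for x by (auto simp: f_def intro!: prod_nonneg)
      ultimately show ?thesis
        using prod_meas[of "tilt \<kappa>" n] tilt_moment[of \<kappa> n] lap[of n] that
        by (subst integral_eq_nn_integral) auto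
    qed
    then show "(\<integral>x. (\<Prod>p\<in>?P. f p x ^ n p) \<partial>tilt \<mu>) = (\<integral>x. (\<Prod>p\<in>?P. f p x ^ n p) \<partial>tilt \<nu>)" by simp
  qed (use f_le tilt_fin tilt_sets in auto)
  then have "tilt \<mu> = tilt \<nu>"
  proof (rule measure_eq_if_distr_eq[OF tilt_sets, rotated -1])
    \<comment> \<open>Summing \<open>- ln\<close> of the coordinates at the diagonal positions gives \<open>(3 r + 2) tr x\<close>, so the trace, and then each entry, can be read off the coordinates.\<close>
    define \<tau> where "\<tau> y = (\<Sum>i<r. - ln (y (i, i))) / (3 * real r + 2)" for y :: "nat \<times> nat \<Rightarrow> real"
    define h where "h y = (\<lambda>p\<in>?P. (- ln (y p) - 3 * \<tau> y) / 2)" for y :: "nat \<times> nat \<Rightarrow> real"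
    show "(\<lambda>x. \<lambda>p\<in>?P. f p x) \<in> measurable (sym_borel r) ?K"
      using f_meas by (intro measurable_restrict) auto
    have comp: "(\<lambda>y. ln (y p)) \<in> borel_measurable ?K" if "p \<in> ?P" for p
      using measurable_component_singleton[OF that, of "\<lambda>_. borel :: real measure"] by (rule borel_measurable_ln)
    have "\<tau> \<in> borel_measurable ?K"
      unfolding \<tau>_def by (intro borel_measurable_divide borel_measurable_sum borel_measurable_uminus comp) auto
    then show "h \<in> measurable ?K ?K"
      unfolding h_def by (intro measurable_restrict borel_measurable_divide borel_measurable_diff
        borel_measurable_times borel_measurable_uminus comp) auto
    fix x :: "real mat" assume "x \<in> sym_mats r"
    have "\<tau> (\<lambda>p\<in>?P. f p x) = (\<Sum>i<r. 3 * tr x + 2 * x $$ (i, i)) / (3 * real r + 2)"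
      by (simp add: \<tau>_def f_def add.commute)
    also have "(\<Sum>i<r. 3 * tr x + 2 * x $$ (i, i)) = (3 * real r + 2) * tr x"
      unfolding sum.distrib sum_distrib_left[symmetric] tr_def[symmetric] by (simp add: distrib_right)
    also have "(3 * real r + 2) * tr x / (3 * real r + 2) = tr x" by simp
    finally have \<tau>: "\<tau> (\<lambda>p\<in>?P. f p x) = tr x" .
    show "h (\<lambda>p\<in>?P. f p x) = (\<lambda>p\<in>?P. x $$ p)"
      unfolding h_def \<tau> by (intro restrict_ext) (simp add: f_def)
  qed
  moreover have "\<kappa> = density (tilt \<kappa>) (\<lambda>x. ennreal (exp (tr x)))" if "sets \<kappa> = sets (sym_borel r)" for \<kappa>
  proof -
    have "(\<lambda>x. ennreal (exp (tr x))) \<in> borel_measurable \<kappa>"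
      using tr_meas by (auto simp: measurable_cong_sets[OF that refl])
    then have "density (tilt \<kappa>) (\<lambda>x. ennreal (exp (tr x))) =
        density \<kappa> (\<lambda>x. ennreal (exp (- tr x)) * ennreal (exp (tr x)))"
      unfolding tilt_def using tr_meas'[OF that] by (intro density_density_eq)
    also have "\<dots> = \<kappa>"
      by (simp add: ennreal_mult'[symmetric] exp_add[symmetric] density_1)
    finally show ?thesis by simp
  qed
  ultimately show ?thesis using sets by metis
qed

section \<open>Gram matrices of staircase arrays\<close>

text \<open>
  With \<open>A = L\<^sup>T L\<close>, the trace of \<open>A V V\<^sup>T\<close> is the squared Frobenius norm of \<open>L V\<close>.
\<close>

lemma mat_inner_gram:
  assumes fac: "triangular_factor r l A" and V: "V \<in> carrier_mat r n"
  shows "mat_inner A (V * transpose_mat V) = (\<Sum>k<r. \<Sum>m<n. (\<Sum>i<r. l k i * V $$ (i, m))\<^sup>2)"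
proof -
  have "mat_inner A (V * transpose_mat V) =
      (\<Sum>i<r. \<Sum>j<r. (\<Sum>k<r. l k i * l k j) * (\<Sum>m<n. V $$ (j, m) * V $$ (i, m)))"
    using fac V by (subst mat_inner_eq_sum[of _ r])
      (auto simp: triangular_factor_def scalar_prod_def atLeast0LessThan intro!: sum.cong)
  also have "\<dots> = (\<Sum>i<r. \<Sum>j<r. \<Sum>k<r. \<Sum>m<n. (l k i * V $$ (i, m)) * (l k j * V $$ (j, m)))"
    by (simp add: sum_product mult_ac)
  also have "\<dots> = (\<Sum>i<r. \<Sum>k<r. \<Sum>j<r. \<Sum>m<n. (l k i * V $$ (i, m)) * (l k j * V $$ (j, m)))"
    by (rule sum.cong[OF refl], rule sum.swap)
  also have "\<dots> = (\<Sum>k<r. \<Sum>i<r. \<Sum>j<r. \<Sum>m<n. (l k i * V $$ (i, m)) * (l k j * V $$ (j, m)))"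
    by (rule sum.swap)
  also have "\<dots> = (\<Sum>k<r. \<Sum>i<r. \<Sum>m<n. \<Sum>j<r. (l k i * V $$ (i, m)) * (l k j * V $$ (j, m)))"
    by (rule sum.cong[OF refl], rule sum.cong[OF refl], rule sum.swap)
  also have "\<dots> = (\<Sum>k<r. \<Sum>m<n. \<Sum>i<r. \<Sum>j<r. (l k i * V $$ (i, m)) * (l k j * V $$ (j, m)))"
    by (rule sum.cong[OF refl], rule sum.swap)
  also have "\<dots> = (\<Sum>k<r. \<Sum>m<n. (\<Sum>i<r. l k i * V $$ (i, m))\<^sup>2)"
    by (simp add: power2_eq_square sum_product)
  finally show ?thesis .
qed

text \<open>
  Arrays of observations are indexed from 1, matrix entries from 0.
\<close>

definition staircase_mat :: "nat \<Rightarrow> (nat \<Rightarrow> nat) \<Rightarrow> (nat \<times> nat \<Rightarrow> real) \<Rightarrow> real mat \<Rightarrow> bool" where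
  "staircase_mat r s w V \<longleftrightarrow> V \<in> carrier_mat r (s r) \<and> (\<forall>i\<in>{1..r}. \<forall>j\<in>{1..s r}.
    V $$ (i - 1, j - 1) = (if j \<le> s i then w (i, j) else 0))"

text \<open>
  Since the rows of \<open>V\<close> grow longer downwards and \<open>L\<close> is lower triangular, \<open>L V\<close> vanishes wherever
  \<open>V\<close> is forced to vanish, and its other entries involve the variable at the same place and the variables
  above it in the same column. The inner sum is written over all places in earlier rows, with coefficient
  zero outside the column, to fit the integral in triangular coordinates with the row as rank.
\<close>

lemma mat_inner_staircase:
  fixes r :: nat and s :: "nat \<Rightarrow> nat" and w :: "nat \<times> nat \<Rightarrow> real"
  defines "I \<equiv> SIGMA i:{1..r}. {1..s i}"
  assumes fac: "triangular_factor r l A" and V: "staircase_mat r s w V"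
    and mono: "mono_on {1..r} s"
  shows "mat_inner A (V * transpose_mat V) =
    (\<Sum>p\<in>I. (l (fst p - 1) (fst p - 1) * w p +
       (\<Sum>q | q \<in> I \<and> fst q < fst p. (if snd q = snd p then l (fst p - 1) (fst q - 1) else 0) * w q))\<^sup>2)"
proof -
  have tri: "\<And>i j. i < j \<Longrightarrow> l i j = 0" using fac by (simp add: triangular_factor_def)
  have Vc: "V \<in> carrier_mat r (s r)" using V by (simp add: staircase_mat_def)
  have Ve: "V $$ (i, j) = (if Suc j \<le> s (Suc i) then w (Suc i, Suc j) else 0)" if "i < r" "j < s r" for i j
    using V that unfolding staircase_mat_def by (force dest: bspec[of _ _ "Suc i"] bspec[of _ _ "Suc j"])
  define z where "z k m = (\<Sum>i<r. l k i * V $$ (i, m))" for k m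
  have zero: "z k m = 0" if "k < r" "m < s r" "\<not> m < s (Suc k)" for k m
    unfolding z_def
  proof (intro sum.neutral ballI)
    fix i assume i: "i \<in> {..<r}"
    show "l k i * V $$ (i, m) = 0"
    proof (cases "k < i")
      case True
      then show ?thesis using tri by simp
    next
      case False
      then have "s (Suc i) \<le> s (Suc k)" using that by (intro mono_onD[OF mono]) auto
      then show ?thesis using Ve[of i m] i that by auto
    qed
  qed
  have val: "z k m = l k k * w (Suc k, Suc m) +
      (\<Sum>q | q \<in> I \<and> fst q < Suc k. (if snd q = Suc m then l k (fst q - 1) else 0) * w q)"
    if km: "k < r" "m < s (Suc k)" for k m
  proof -
    have m: "m < s r" using km mono_onD[OF mono, of "Suc k" r] by simp
    have set: "{q. q \<in> I \<and> fst q < Suc k} = (SIGMA i:{1..k}. {1..s i})"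
      using km by (auto simp: I_def)
    have "(\<Sum>q | q \<in> I \<and> fst q < Suc k. (if snd q = Suc m then l k (fst q - 1) else 0) * w q) =
        (\<Sum>i\<in>{1..k}. \<Sum>j\<in>{1..s i}. (if j = Suc m then l k (i - 1) else 0) * w (i, j))"
      unfolding set by (subst sum.Sigma) (auto intro!: sum.cong)
    also have "\<dots> = (\<Sum>i\<in>{1..k}. if Suc m \<le> s i then l k (i - 1) * w (i, Suc m) else 0)"
      by (intro sum.cong refl) (simp add: if_distrib[of "\<lambda>c. c * _"] cong: if_cong)
    also have "\<dots> = (\<Sum>i<k. if Suc m \<le> s (Suc i) then l k i * w (Suc i, Suc m) else 0)"
      by (simp add: sum.atLeast1_atMost_eq cong: if_cong)
    also have "\<dots> = (\<Sum>i<k. l k i * V $$ (i, m))"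
      using km m by (intro sum.cong refl) (auto simp: Ve)
    finally have lower: "(\<Sum>q | q \<in> I \<and> fst q < Suc k. (if snd q = Suc m then l k (fst q - 1) else 0) * w q) =
        (\<Sum>i<k. l k i * V $$ (i, m))" .
    have "z k m = (\<Sum>i<Suc k. l k i * V $$ (i, m))"
      unfolding z_def using km tri by (intro sum.mono_neutral_right) auto
    also have "\<dots> = l k k * V $$ (k, m) + (\<Sum>i<k. l k i * V $$ (i, m))" by simp
    also have "V $$ (k, m) = w (Suc k, Suc m)" using km m by (simp add: Ve)
    finally show ?thesis unfolding lower .
  qed
  have "mat_inner A (V * transpose_mat V) = (\<Sum>k<r. \<Sum>m<s r. (z k m)\<^sup>2)"
    unfolding z_def by (rule mat_inner_gram[OF fac Vc])
  also have "\<dots> = (\<Sum>k<r. \<Sum>m<s (Suc k). (z k m)\<^sup>2)"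
  proof (rule sum.cong[OF refl], rule sum.mono_neutral_right)
    fix k assume k: "k \<in> {..<r}"
    show "{..<s (Suc k)} \<subseteq> {..<s r}" using k mono_onD[OF mono, of "Suc k" r] by auto
    show "\<forall>m\<in>{..<s r} - {..<s (Suc k)}. (z k m)\<^sup>2 = 0" using k zero by auto
  qed auto
  also have "\<dots> = (\<Sum>i\<in>{1..r}. \<Sum>j\<in>{1..s i}. (z (i - 1) (j - 1))\<^sup>2)"
    by (simp add: sum.atLeast1_atMost_eq)
  also have "\<dots> = (\<Sum>p\<in>I. (z (fst p - 1) (snd p - 1))\<^sup>2)"
    unfolding I_def by (subst sum.Sigma) (auto intro!: sum.cong)
  also have "\<dots> = (\<Sum>p\<in>I. (l (fst p - 1) (fst p - 1) * w p +
       (\<Sum>q | q \<in> I \<and> fst q < fst p. (if snd q = snd p then l (fst p - 1) (fst q - 1) else 0) * w q))\<^sup>2)"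
  proof (intro sum.cong refl)
    fix p assume "p \<in> I"
    then obtain k m where p: "p = (Suc k, Suc m)" "k < r" "m < s (Suc k)"
      by (intro that[of "fst p - 1" "snd p - 1"]) (auto simp: I_def)
    show "(z (fst p - 1) (snd p - 1))\<^sup>2 = (l (fst p - 1) (fst p - 1) * w p +
       (\<Sum>q | q \<in> I \<and> fst q < fst p. (if snd q = snd p then l (fst p - 1) (fst q - 1) else 0) * w q))\<^sup>2"
      using val[OF p(2,3)] unfolding p(1) by (simp cong: if_cong)
  qed
  finally show ?thesis .
qed

lemma triangular_factor_half_identity:
  "triangular_factor r (\<lambda>i j. if i = j then 1 / sqrt 2 else 0) ((1/2) \<cdot>\<^sub>m 1\<^sub>m r)"
  by (auto simp: triangular_factor_def if_distrib[of "\<lambda>c. c * _"] cong: if_cong)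

lemma mat_inner_half_identity_staircase:
  fixes s :: "nat \<Rightarrow> nat" and w :: "nat \<times> nat \<Rightarrow> real"
  assumes V: "staircase_mat r s w V"
    and mono: "mono_on {1..r} s"
  shows "mat_inner ((1/2) \<cdot>\<^sub>m 1\<^sub>m r) (V * transpose_mat V) = (\<Sum>p\<in>(SIGMA i:{1..r}. {1..s i}). (w p)\<^sup>2 / 2)"
proof -
  have "(\<Sum>q | q \<in> (SIGMA i:{1..r}. {1..s i}) \<and> fst q < fst p.
      (if snd q = snd p then if fst p - 1 = fst q - 1 then 1 / sqrt 2 else 0 else 0) * w q) = 0" for p
    by (intro sum.neutral) auto
  then show ?thesis
    unfolding mat_inner_staircase[OF triangular_factor_half_identity V mono]
    by (simp add: power_divide)
qed

lemma gen_power_half_identity: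
  "gen_power r t (mat_inv ((1/2) \<cdot>\<^sub>m 1\<^sub>m r)) = (\<Prod>i<r. 2 powr t (Suc i))"
  by (subst gen_power_mat_inv[OF triangular_factor_half_identity]) (simp add: power_divide)

section \<open>Riesz measures and the law of the Gram matrix\<close>

text \<open>
  Solving the defining equations of \<open>Xi\<close> from the first coordinate on gives
  \<open>u\<^sub>k = (s\<^sub>k - N\<^sub>k) / 2\<close>, where \<open>N\<^sub>k\<close> counts the earlier nonzero \<open>u\<^sub>i\<close>. The count increases by one only
  when \<open>N\<^sub>k < s\<^sub>k\<close>, and then it is at most \<open>s\<^sub>k \<le> s\<^sub>k\<^sub>+\<^sub>1\<close>; this keeps all \<open>u\<^sub>k\<close> nonnegative, the count being an
  integer.
\<close>

lemma half_nondecreasing_in_Xi: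
  fixes s :: "nat \<Rightarrow> nat"
  assumes mono: "\<And>i. 1 \<le> i \<Longrightarrow> i < r \<Longrightarrow> s i \<le> s (i + 1)"
  shows "(\<lambda>i. real (s i) / 2) \<in> Xi r"
proof -
  \<comment> \<open>The guard \<open>1 \<le> k\<close> skips the index 0, at which parameters carry no meaning.\<close>
  define N where "N = rec_nat 0 (\<lambda>k m. m + (if 1 \<le> k \<and> s k \<noteq> m then 1 else 0 :: nat))"
  have N_Suc: "N (Suc k) = N k + (if 1 \<le> k \<and> s k \<noteq> N k then 1 else 0)" and N_1: "N (Suc 0) = 0" for k
    by (simp_all add: N_def)
  define u where "u k = (real (s k) - real (N k)) / 2" for k
  have N_sum: "(\<Sum>i = 1..<Suc k. eps (u i)) = real (N (Suc k))" for k
  proof (induction k)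
    case 0
    then show ?case by (simp add: N_1)
  next
    case (Suc k)
    then show ?case by (simp add: N_Suc[of "Suc k"] eps_def u_def)
  qed
  have N_le: "Suc k \<le> r \<Longrightarrow> N (Suc k) \<le> s (Suc k)" for k
  proof (induction k)
    case 0
    then show ?case by (simp add: N_1)
  next
    case (Suc k)
    then have "N (Suc k) \<le> s (Suc k)" "s (Suc k) \<le> s (Suc (Suc k))"
      using mono[of "Suc k"] by auto
    then show ?case using N_Suc[of "Suc k"] by auto
  qed
  have "u k \<ge> 0 \<and> real (s k) / 2 = u k + 1/2 * (\<Sum>i = 1..<k. eps (u i))" if "k \<in> {1..r}" for k
  proof -
    from that obtain m where "k = Suc m" "Suc m \<le> r" by (cases k) auto
    then show ?thesis using N_le[of m] unfolding \<open>k = Suc m\<close> N_sum by (simp add: u_def field_simps)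
  qed
  then show ?thesis unfolding Xi_def by (intro CollectI exI[of _ u] ballI)
qed

text \<open>
  The definite description behind \<open>riesz_measure\<close> selects a measure as soon as one representing measure
  satisfies the support condition of the uniqueness theorem.
\<close>

lemma riesz_measure_eqI:
  assumes R: "is_riesz_measure r t R"
    and nonneg: "\<And>A. A \<in> pos_def_mats r \<Longrightarrow> AE x in R. mat_inner A x \<ge> 0"
  shows "riesz_measure r t = R"
  unfolding riesz_measure_def
proof (rule the_equality, rule R)
  fix R' assume R': "is_riesz_measure r t R'"
  have neg: "- (- A) = A" if "A \<in> carrier_mat r r" for A :: "real mat"
    using that by (intro eq_matI) auto
  have val: "laplace Q (- A) = ennreal (gen_power r t (- mat_inv (- A)))"
    if "is_riesz_measure r t Q" "A \<in> pos_def_mats r" for Q A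
    using that neg[OF pos_def_matsD(1)[OF that(2)]] unfolding is_riesz_measure_def by auto
  have "R = R'"
  proof (rule laplace_injective[OF _ _ _ _ nonneg])
    show "sets R = sets (sym_borel r)" "sets R' = sets (sym_borel r)"
      using R R' by (auto simp: is_riesz_measure_def)
    show "laplace R (- A) < \<infinity>" "laplace R' (- A) = laplace R (- A)" if "A \<in> pos_def_mats r" for A
      using val[OF R that] val[OF R' that] by simp_all
  qed
  then show "R' = R" ..
qed

lemma distr_indep_std_normal:
  fixes X :: "'i \<Rightarrow> 'a \<Rightarrow> real"
  assumes "prob_space M" "I \<noteq> {}" and indep: "prob_space.indep_vars M (\<lambda>_. borel) X I"
    and law: "\<And>p. p \<in> I \<Longrightarrow> distributed M lborel (X p) std_normal_density"
  shows "distr M (\<Pi>\<^sub>M p\<in>I. borel) (\<lambda>\<omega>. \<lambda>p\<in>I. X p \<omega>) = (\<Pi>\<^sub>M p\<in>I. density lborel std_normal_density)"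
proof -
  interpret prob_space M by fact
  have rv: "random_variable borel (X p)" if "p \<in> I" for p
    using distributed_measurable[OF law[OF that]] by simp
  have "distr M (\<Pi>\<^sub>M p\<in>I. borel) (\<lambda>\<omega>. \<lambda>p\<in>I. X p \<omega>) = (\<Pi>\<^sub>M p\<in>I. distr M borel (X p))"
    using indep by (subst (asm) indep_vars_iff_distr_eq_PiM'[OF \<open>I \<noteq> {}\<close> rv])
  also have "\<dots> = (\<Pi>\<^sub>M p\<in>I. density lborel std_normal_density)"
  proof (intro PiM_cong refl)
    fix p assume "p \<in> I"
    have "distr M borel (X p) = distr M lborel (X p)" by (intro distr_cong) auto
    also have "\<dots> = density lborel std_normal_density"
      using law[OF \<open>p \<in> I\<close>] by (rule distributed_distr_eq_density)
    finally show "distr M borel (X p) = density lborel std_normal_density" .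
  qed
  finally show ?thesis .
qed

theorem theorem3p1:
  fixes M :: "'a measure" and r :: nat and s :: "nat \<Rightarrow> nat"
    and u :: "nat \<Rightarrow> nat \<Rightarrow> 'a \<Rightarrow> real" and U :: "'a \<Rightarrow> real mat"
  assumes "prob_space M"
    and "r \<ge> 1"
    and "0 < s 1"
    and "\<And>i. 1 \<le> i \<Longrightarrow> i < r \<Longrightarrow> s i \<le> s (i + 1)"
    and "prob_space.indep_vars M (\<lambda>_. borel) (\<lambda>(i, j). u i j) (SIGMA i:{1..r}. {1..s i})"
    and "\<And>i j. i \<in> {1..r} \<Longrightarrow> j \<in> {1..s i} \<Longrightarrow> distributed M lborel (u i j) std_normal_density"
    and "\<And>\<omega>. \<omega> \<in> space M \<Longrightarrow> U \<omega> \<in> carrier_mat r (s r)"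
    and "\<And>\<omega> i j. \<omega> \<in> space M \<Longrightarrow> i \<in> {1..r} \<Longrightarrow> j \<in> {1..s r} \<Longrightarrow>
      U \<omega> $$ (i - 1, j - 1) = (if j \<le> s i then u i j \<omega> else 0)"
  shows "(\<lambda>i. real (s i) / 2) \<in> Xi r \<and>
    distr M (sym_borel r) (\<lambda>\<omega>. U \<omega> * transpose_mat (U \<omega>)) =
      riesz_distribution r (\<lambda>i. real (s i) / 2) ((1/2) \<cdot>\<^sub>m 1\<^sub>m r)"
proof
  show "(\<lambda>i. real (s i) / 2) \<in> Xi r" by (rule half_nondecreasing_in_Xi) (rule assms(4))
  interpret prob_space M by fact
  define I where "I = (SIGMA i:{1..r}. {1..s i})"
  have "finite I" by (simp add: I_def)
  have "(1, 1) \<in> I" using assms(2,3) by (simp add: I_def)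
  then have "I \<noteq> {}" by blast
  define W where "W p = (case p of (i, j) \<Rightarrow> u i j)" for p
  define X where "X \<omega> = U \<omega> * transpose_mat (U \<omega>)" for \<omega>
  define t where "t i = real (s i) / 2" for i
  define c where "c = gen_power r t (mat_inv ((1/2) \<cdot>\<^sub>m 1\<^sub>m r))"
  have mono: "mono_on {1..r} s"
  proof (rule mono_onI)
    fix i j assume i: "i \<in> {1..r}" and "j \<in> {1..r}" "i \<le> j"
    from \<open>i \<le> j\<close> \<open>j \<in> {1..r}\<close> show "s i \<le> s j"
    proof (induction j rule: dec_induct)
      case base
      then show ?case by simp
    next
      case (step n)
      then show ?case using assms(4)[of n] i by simp
    qed
  qed
  have stair: "staircase_mat r s (\<lambda>p. W p \<omega>) (U \<omega>)" if "\<omega> \<in> space M" for \<omega>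
    using assms(7,8) that by (simp add: staircase_mat_def W_def)
  have law: "distributed M lborel (W p) std_normal_density" if "p \<in> I" for p
    using that assms(6) by (auto simp: W_def I_def)
  have W_meas: "W p \<in> borel_measurable M" if "p \<in> I" for p
    using distributed_measurable[OF law[OF that]] by simp
  have joint: "distr M (\<Pi>\<^sub>M p\<in>I. borel) (\<lambda>\<omega>. \<lambda>p\<in>I. W p \<omega>) = (\<Pi>\<^sub>M p\<in>I. density lborel std_normal_density)"
    using assms(5) unfolding I_def[symmetric] W_def[symmetric, abs_def]
    by (intro distr_indep_std_normal law \<open>I \<noteq> {}\<close> prob_space_axioms) (simp_all add: W_def[abs_def])
  have X_meas: "X \<in> measurable M (sym_borel r)"
  proof (rule measurable_sym_borelI)
    fix \<omega> assume "\<omega> \<in> space M"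
    then have U: "U \<omega> \<in> carrier_mat r (s r)" by (rule assms(7))
    then show "X \<omega> \<in> sym_mats r"
      by (auto simp: X_def sym_mats_def transpose_mult[OF U transpose_carrier_mat[THEN iffD2, OF U]])
  next
    fix p assume p: "p \<in> {..<r} \<times> {..<r}"
    have U_entry: "(\<lambda>\<omega>. U \<omega> $$ (i, m)) \<in> borel_measurable M" if "i < r" "m < s r" for i m
    proof -
      have "(\<lambda>\<omega>. if Suc m \<le> s (Suc i) then W (Suc i, Suc m) \<omega> else 0) \<in> borel_measurable M"
        using that W_meas[of "(Suc i, Suc m)"] by (cases "Suc m \<le> s (Suc i)") (auto simp: I_def)
      then show ?thesis
        using assms(8)[of _ "Suc i" "Suc m"] that
        by (subst measurable_cong[where g = "\<lambda>\<omega>. if Suc m \<le> s (Suc i) then W (Suc i, Suc m) \<omega> else 0"])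
          (auto simp: W_def)
    qed
    have "(\<lambda>\<omega>. \<Sum>m<s r. U \<omega> $$ (fst p, m) * U \<omega> $$ (snd p, m)) \<in> borel_measurable M"
      using p by (intro borel_measurable_sum borel_measurable_times U_entry) auto
    moreover have "X \<omega> $$ p = (\<Sum>m<s r. U \<omega> $$ (fst p, m) * U \<omega> $$ (snd p, m))" if "\<omega> \<in> space M" for \<omega>
      using p assms(7)[OF that] by (cases p) (auto simp: X_def scalar_prod_def atLeast0LessThan intro!: sum.cong)
    ultimately show "(\<lambda>\<omega>. X \<omega> $$ p) \<in> borel_measurable M"
      by (subst measurable_cong) auto
  qed
  have half_carrier: "(1/2) \<cdot>\<^sub>m 1\<^sub>m r \<in> carrier_mat r r" by simp
  have c_eq: "c = (\<Prod>i<r. 2 powr t (Suc i))" unfolding c_def by (rule gen_power_half_identity)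
  then have "c > 0" by (auto intro!: prod_pos)
  define D where "D = distr M (sym_borel r) X"
  \<comment> \<open>The Riesz measure is recovered from its exponentially tilted version \<open>D\<close> by undoing the tilt.\<close>
  define R where "R = density D (\<lambda>x. ennreal (c * exp (mat_inner ((1/2) \<cdot>\<^sub>m 1\<^sub>m r) x)))"
  have weight_meas: "(\<lambda>x. ennreal (a * exp (b * mat_inner ((1/2) \<cdot>\<^sub>m 1\<^sub>m r) x))) \<in> borel_measurable D" for a b
    using measurable_mat_inner[OF half_carrier] by (simp add: D_def)
  have exp_meas: "(\<lambda>x. ennreal (exp (mat_inner (- A) x))) \<in> borel_measurable D" if "A \<in> carrier_mat r r" for A
    using measurable_mat_inner[of "- A" r] that by (simp add: D_def)
  have "laplace R (- A) = ennreal (gen_power r t (- mat_inv (- A)))" if A: "A \<in> pos_def_mats r" for A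
  proof -
    obtain l where fac: "triangular_factor r l A" using pos_def_triangular_factor[OF A] .
    have A_carrier: "A \<in> carrier_mat r r" using pos_def_matsD(1)[OF A] .
    have l_pos: "l i i > 0" if "i < r" for i using fac that by (simp add: triangular_factor_def)
    define a where "a p = l (fst p - 1) (fst p - 1)" for p :: "nat \<times> nat"
    define b where "b p q = (if snd q = snd p then l (fst p - 1) (fst q - 1) else 0)" for p q :: "nat \<times> nat"
    define h where "h w = (\<Prod>p\<in>I. exp ((w p)\<^sup>2 / 2 -
        (a p * w p + (\<Sum>q | q \<in> I \<and> fst q < fst p. b p q * w q))\<^sup>2))" for w :: "nat \<times> nat \<Rightarrow> real"
    have h_meas: "h \<in> borel_measurable (\<Pi>\<^sub>M p\<in>I. borel)"
      unfolding h_def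
      by (intro borel_measurable_prod borel_measurable_exp[THEN measurable_compose[rotated]]
          borel_measurable_diff borel_measurable_divide borel_measurable_power borel_measurable_add
          borel_measurable_times borel_measurable_sum borel_measurable_const measurable_component_singleton) auto
    \<comment> \<open>The weight of \<open>R\<close> supplies the terms \<open>(W p)\<^sup>2 / 2\<close> that cancel the Gaussian density.\<close>
    have h_X: "exp (mat_inner ((1/2) \<cdot>\<^sub>m 1\<^sub>m r) (X \<omega>)) * exp (mat_inner (- A) (X \<omega>)) = h (\<lambda>p\<in>I. W p \<omega>)"
      if \<omega>: "\<omega> \<in> space M" for \<omega>
    proof -
      have "X \<omega> \<in> carrier_mat r r"
        using measurable_space[OF X_meas \<omega>] by (auto dest: sym_matsD(1))
      then have "mat_inner (- A) (X \<omega>) = - mat_inner A (X \<omega>)"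
        by (rule mat_inner_uminus[OF A_carrier])
      also have "mat_inner A (X \<omega>) =
          (\<Sum>p\<in>I. (a p * W p \<omega> + (\<Sum>q | q \<in> I \<and> fst q < fst p. b p q * W q \<omega>))\<^sup>2)"
        unfolding X_def a_def b_def I_def by (rule mat_inner_staircase[OF fac stair[OF \<omega>] mono])
      finally have "exp (mat_inner ((1/2) \<cdot>\<^sub>m 1\<^sub>m r) (X \<omega>)) * exp (mat_inner (- A) (X \<omega>)) =
          exp (\<Sum>p\<in>I. (W p \<omega>)\<^sup>2 / 2 - (a p * W p \<omega> + (\<Sum>q | q \<in> I \<and> fst q < fst p. b p q * W q \<omega>))\<^sup>2)"
        unfolding X_def mat_inner_half_identity_staircase[OF stair[OF \<omega>] mono] I_def[symmetric]
        by (simp add: exp_add[symmetric] sum_subtractf)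
      also have "\<dots> = h (\<lambda>p\<in>I. W p \<omega>)"
        unfolding h_def exp_sum[OF \<open>finite I\<close>] by (intro prod.cong refl) simp
      finally show ?thesis .
    qed
    have "laplace R (- A) = (\<integral>\<^sup>+x. ennreal (c * exp (mat_inner ((1/2) \<cdot>\<^sub>m 1\<^sub>m r) x)) *
        ennreal (exp (mat_inner (- A) x)) \<partial>D)"
      unfolding laplace_def R_def
      using weight_meas[of c 1] exp_meas[OF A_carrier] by (intro nn_integral_density) simp_all
    also have "\<dots> = (\<integral>\<^sup>+\<omega>. ennreal (c * exp (mat_inner ((1/2) \<cdot>\<^sub>m 1\<^sub>m r) (X \<omega>))) *
        ennreal (exp (mat_inner (- A) (X \<omega>))) \<partial>M)"
      unfolding D_def using weight_meas[of c 1] exp_meas[OF A_carrier]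
      by (intro nn_integral_distr[OF X_meas] borel_measurable_times_ennreal) (simp_all add: D_def)
    also have "\<dots> = (\<integral>\<^sup>+\<omega>. ennreal c * ennreal (h (\<lambda>p\<in>I. W p \<omega>)) \<partial>M)"
      using \<open>c > 0\<close> by (intro nn_integral_cong) (simp add: ennreal_mult'[symmetric] mult.assoc h_X)
    also have "\<dots> = (\<integral>\<^sup>+w. ennreal c * ennreal (h w) \<partial>distr M (\<Pi>\<^sub>M p\<in>I. borel) (\<lambda>\<omega>. \<lambda>p\<in>I. W p \<omega>))"
      using h_meas W_meas by (subst nn_integral_distr) (auto intro!: measurable_restrict)
    also have "\<dots> = ennreal c * (\<integral>\<^sup>+w. ennreal (h w) \<partial>(\<Pi>\<^sub>M p\<in>I. density lborel std_normal_density))"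
      unfolding joint[symmetric] using h_meas by (intro nn_integral_cmult) simp
    also have "(\<integral>\<^sup>+w. ennreal (h w) \<partial>(\<Pi>\<^sub>M p\<in>I. density lborel std_normal_density)) =
        ennreal (\<Prod>p\<in>I. 1 / (sqrt 2 * a p))"
      unfolding h_def using \<open>finite I\<close>
      by (rule nn_integral_gaussian_triangular) (auto simp: a_def I_def intro!: l_pos)
    also have "(\<Prod>p\<in>I. 1 / (sqrt 2 * a p)) = (\<Prod>i<r. (1 / (sqrt 2 * l i i)) ^ s (Suc i))"
    proof -
      have "(\<Prod>p\<in>I. 1 / (sqrt 2 * a p)) = (\<Prod>i\<in>{1..r}. \<Prod>j\<in>{1..s i}. 1 / (sqrt 2 * a (i, j)))"
        unfolding I_def by (subst prod.Sigma) (auto intro!: prod.cong)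
      also have "\<dots> = (\<Prod>i\<in>{1..r}. (1 / (sqrt 2 * l (i - 1) (i - 1))) ^ s i)"
        by (simp add: a_def)
      also have "\<dots> = (\<Prod>i<r. (1 / (sqrt 2 * l i i)) ^ s (Suc i))"
        by (simp add: prod.atLeast1_atMost_eq)
      finally show ?thesis .
    qed
    also have "ennreal c * ennreal (\<Prod>i<r. (1 / (sqrt 2 * l i i)) ^ s (Suc i)) =
        ennreal (\<Prod>i<r. 2 powr t (Suc i) * (1 / (sqrt 2 * l i i)) ^ s (Suc i))"
      using \<open>c > 0\<close> by (simp add: ennreal_mult'[symmetric] c_eq prod.distrib)
    also have "(\<Prod>i<r. 2 powr t (Suc i) * (1 / (sqrt 2 * l i i)) ^ s (Suc i)) =
        (\<Prod>i<r. (1 / (l i i)\<^sup>2) powr t (Suc i))"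
    proof (intro prod.cong refl)
      fix i assume "i \<in> {..<r}"
      then have l: "l i i > 0" using l_pos by simp
      then have "(1 / (sqrt 2 * l i i)) ^ s (Suc i) = (1 / (sqrt 2 * l i i)) powr (2 * t (Suc i))"
        by (simp add: t_def powr_realpow)
      also have "\<dots> = ((1 / (sqrt 2 * l i i)) powr 2) powr t (Suc i)"
        by (simp add: powr_powr)
      also have "(1 / (sqrt 2 * l i i)) powr 2 = 1 / (2 * (l i i)\<^sup>2)"
        using l by (simp add: powr_numeral power_divide power_mult_distrib)
      finally show "2 powr t (Suc i) * (1 / (sqrt 2 * l i i)) ^ s (Suc i) = (1 / (l i i)\<^sup>2) powr t (Suc i)"
        using l by (simp add: powr_mult[symmetric])
    qed
    also have "\<dots> = gen_power r t (- mat_inv (- A))"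
      by (rule gen_power_uminus_mat_inv[OF fac, symmetric])
    finally show ?thesis .
  qed
  note laplace_R = this
  have "is_riesz_measure r t R"
    unfolding is_riesz_measure_def
  proof (intro conjI allI impI)
    show "sets R = sets (sym_borel r)" by (simp add: R_def D_def)
    fix \<theta> assume "- \<theta> \<in> pos_def_mats r"
    moreover have "- (- \<theta>) = \<theta>" by (intro eq_matI) auto
    ultimately show "laplace R \<theta> = ennreal (gen_power r t (- mat_inv \<theta>))"
      using laplace_R[of "- \<theta>"] by simp
  qed
  moreover have "AE x in R. mat_inner A x \<ge> 0" if A: "A \<in> pos_def_mats r" for A
  proof -
    obtain l where fac: "triangular_factor r l A" using pos_def_triangular_factor[OF A] .
    have "mat_inner A (X \<omega>) \<ge> 0" if "\<omega> \<in> space M" for \<omega>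
      unfolding X_def mat_inner_gram[OF fac assms(7)[OF that]] by (intro sum_nonneg) simp
    moreover have "{x \<in> space (sym_borel r). 0 \<le> mat_inner A x} \<in> sets (sym_borel r)"
    proof -
      note [measurable] = measurable_mat_inner[OF pos_def_matsD(1)[OF A]]
      show ?thesis by measurable
    qed
    ultimately have "AE x in D. mat_inner A x \<ge> 0"
      unfolding D_def using X_meas by (subst AE_distr_iff) auto
    then show ?thesis
      unfolding R_def using weight_meas[of c 1] by (subst AE_density) auto
  qed
  ultimately have riesz: "riesz_measure r t = R" by (rule riesz_measure_eqI)
  have "riesz_distribution r t ((1/2) \<cdot>\<^sub>m 1\<^sub>m r) =
      density D (\<lambda>x. ennreal (c * exp (mat_inner ((1/2) \<cdot>\<^sub>m 1\<^sub>m r) x)) *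
        ennreal (exp (- mat_inner ((1/2) \<cdot>\<^sub>m 1\<^sub>m r) x) / c))"
    unfolding riesz_distribution_def riesz c_def[symmetric] R_def
    using weight_meas[of c 1] weight_meas[of "1 / c" "-1"] by (intro density_density_eq) simp_all
  also have "\<dots> = density D (\<lambda>_. 1)"
    using \<open>c > 0\<close> by (intro density_cong) (simp_all add: ennreal_mult'[symmetric] exp_minus)
  also have "\<dots> = D" by (rule density_1)
  finally have "D = riesz_distribution r t ((1/2) \<cdot>\<^sub>m 1\<^sub>m r)" ..
  then show "distr M (sym_borel r) (\<lambda>\<omega>. U \<omega> * transpose_mat (U \<omega>)) =
      riesz_distribution r (\<lambda>i. real (s i) / 2) ((1/2) \<cdot>\<^sub>m 1\<^sub>m r)"
    by (simp add: D_def X_def[abs_def] t_def[abs_def])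
qed

end
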